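(* Let $n,a,a',d$ be nonnegative integers such that $n>0$, $\max\{a,a'\}\le n$, $a\equiv a'\equiv n\pmod 2$, and $d\le\min\{a,a',\frac{n-a}{2},\frac{n-a'}{2}\}$. For $b\in\{a,a'\}$ let $R(\mathcal{M}_{n,b})_d$ be the degree $d$ component of the orbit harmonics ring of the locus $\mathcal{M}_{n,b}$ of permutation matrices of involutions in $\mathfrak{S}_n$ with exactly $b$ fixed points. Then there is an isomorphism of $\mathfrak{S}_n$-modules $$R(\mathcal{M}_{n,a})_d\cong R(\mathcal{M}_{n,a'})_d.$$
   Context: Let $\mathcal{M}_{n,a}=\{w\in\mathfrak{S}_n : w^2=1 \text{ and } w \text{ has exactly } a \text{ fixed points}\}$, with each $w$ identified with its $n\times n$ permutation matrix, so $\mathcal{M}_{n,a}\subseteq \mathrm{Mat}_{n\times n}(\mathbb{C})$ is a finite set on which $\mathfrak{S}_n$ acts by conjugation. Let $\mathbb{C}[\mathbf{x}_{n\times n}]$ be the polynomial ring in the variables $x_{i,j}$, $1\le i,j\le n$, with the induced action $g\cdot x_{i,j}=x_{g(i),g(j)}$ of $\mathfrak{S}_n$. Let $\mathbf{I}(\mathcal{M}_{n,a})$ be the ideal of polynomials vanishing on $\mathcal{M}_{n,a}$. For an ideal $I$, let $\mathrm{gr}\, I$ be the ideal generated by the highest-degree homogeneous components of all nonzero $g\in I$. Put $R(\mathcal{M}_{n,a})=\mathbb{C}[\mathbf{x}_{n\times n}]/\mathrm{gr}\,\mathbf{I}(\mathcal{M}_{n,a})$, a graded $\mathfrak{S}_n$-module,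 with degree $d$ component $R(\mathcal{M}_{n,a})_d$. *)

theory Defs
  imports
    Complex_Main
    "HOL-Library.Poly_Mapping"
    "HOL-Number_Theory.Cong"
    "HOL-Algebra.Sym_Groups"
    "HOL-Algebra.QuotRing"
    "HOL-Algebra.Module"
begin

section \<open>Linear representations of a group\<close>

text \<open>The fields \<open>mult\<close> and \<open>one\<close> inherited from the record of modules are not constrained
  by the locale \<^locale>\<open>module\<close> and play no role.\<close>

record ('k, 'v, 'g) rep = "('k, 'v) module" +
  act :: "'g \<Rightarrow> 'v \<Rightarrow> 'v"

locale representation = group G + module K V for G (structure) and K and V +
  assumes act_closed: "\<lbrakk>g \<in> carrier G; x \<in> carrier V\<rbrakk> \<Longrightarrow> act V g x \<in> carrier V"
    and act_add: "\<lbrakk>g \<in> carrier G; x \<in> carrier V; y \<in> carrier V\<rbrakk>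
      \<Longrightarrow> act V g (x \<oplus>\<^bsub>V\<^esub> y) = act V g x \<oplus>\<^bsub>V\<^esub> act V g y"
    and act_smult: "\<lbrakk>g \<in> carrier G; c \<in> carrier K; x \<in> carrier V\<rbrakk>
      \<Longrightarrow> act V g (c \<odot>\<^bsub>V\<^esub> x) = c \<odot>\<^bsub>V\<^esub> act V g x"
    and act_one: "x \<in> carrier V \<Longrightarrow> act V \<one> x = x"
    and act_mult: "\<lbrakk>g \<in> carrier G; h \<in> carrier G; x \<in> carrier V\<rbrakk>
      \<Longrightarrow> act V (g \<otimes> h) x = act V g (act V h x)"

definition rep_iso :: "('g, 'm) monoid_scheme \<Rightarrow> ('k, 'r) ring_scheme
    \<Rightarrow> ('k, 'v, 'g) rep \<Rightarrow> ('k, 'w, 'g) rep \<Rightarrow> ('v \<Rightarrow> 'w) set"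
  where "rep_iso G K V W = {f. bij_betw f (carrier V) (carrier W)
    \<and> (\<forall>x\<in>carrier V. \<forall>y\<in>carrier V. f (x \<oplus>\<^bsub>V\<^esub> y) = f x \<oplus>\<^bsub>W\<^esub> f y)
    \<and> (\<forall>c\<in>carrier K. \<forall>x\<in>carrier V. f (c \<odot>\<^bsub>V\<^esub> x) = c \<odot>\<^bsub>W\<^esub> f x)
    \<and> (\<forall>g\<in>carrier G. \<forall>x\<in>carrier V. f (act V g x) = act W g (f x))}"

definition rep_isomorphic :: "('g, 'm) monoid_scheme \<Rightarrow> ('k, 'r) ring_scheme
    \<Rightarrow> ('k, 'v, 'g) rep \<Rightarrow> ('k, 'w, 'g) rep \<Rightarrow> bool"
  where "rep_isomorphic G K V W \<longleftrightarrow>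
    representation G K V \<and> representation G K W \<and> rep_iso G K V W \<noteq> {}"

definition complex_ring :: "complex ring"
  where "complex_ring = \<lparr>carrier = UNIV, mult = (*), one = 1, zero = 0, add = (+)\<rparr>"


section \<open>Polynomials in matrix variables\<close>

text \<open>The variable \<open>x\<^sub>i\<^sub>j\<close> is indexed by the pair \<open>(i, j)\<close>; a monomial is its finitely
  supported exponent function.\<close>

type_synonym monomial = "nat \<times> nat \<Rightarrow>\<^sub>0 nat"
type_synonym mat_poly = "monomial \<Rightarrow>\<^sub>0 complex"

definition Const :: "complex \<Rightarrow> mat_poly"
  where "Const c = Poly_Mapping.single 0 c"

definition Var :: "nat \<times> nat \<Rightarrow> mat_poly"
  where "Var v = Poly_Mapping.single (Poly_Mapping.single v 1) 1"

definition mat_poly_ring :: "nat \<Rightarrow> mat_poly ring"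
  where "mat_poly_ring n =
    \<lparr>carrier = {p. \<forall>m\<in>Poly_Mapping.keys p. Poly_Mapping.keys m \<subseteq> {1..n} \<times> {1..n}},
     mult = (*), one = 1, zero = 0, add = (+)\<rparr>"

text \<open>Substitution of \<open>x\<close> for the variables, with coefficients mapped by \<open>c\<close>.\<close>

definition poly_eval ::
    "(complex \<Rightarrow> 'a::comm_ring_1) \<Rightarrow> (nat \<times> nat \<Rightarrow> 'a) \<Rightarrow> mat_poly \<Rightarrow> 'a"
  where "poly_eval c x p =
    (\<Sum>m\<in>Poly_Mapping.keys p. c (Poly_Mapping.lookup p m) *
      (\<Prod>v\<in>Poly_Mapping.keys m. x v ^ Poly_Mapping.lookup m v))"

definition poly_act :: "(nat \<Rightarrow> nat) \<Rightarrow> mat_poly \<Rightarrow> mat_poly"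
  where "poly_act g = poly_eval Const (\<lambda>(i, j). Var (g i, g j))"

definition mon_degree :: "monomial \<Rightarrow> nat"
  where "mon_degree m = (\<Sum>v\<in>Poly_Mapping.keys m. Poly_Mapping.lookup m v)"

definition homogeneous :: "nat \<Rightarrow> mat_poly \<Rightarrow> bool"
  where "homogeneous d p \<longleftrightarrow> (\<forall>m\<in>Poly_Mapping.keys p. mon_degree m = d)"

definition hom_component :: "nat \<Rightarrow> mat_poly \<Rightarrow> mat_poly"
  where "hom_component d p =
    (\<Sum>m | m \<in> Poly_Mapping.keys p \<and> mon_degree m = d.
      Poly_Mapping.single m (Poly_Mapping.lookup p m))"

text \<open>Only meaningful for nonzero polynomials.\<close>

definition total_degree :: "mat_poly \<Rightarrow> nat"
  where "total_degree p = Max (mon_degree ` Poly_Mapping.keys p)"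

definition top_component :: "mat_poly \<Rightarrow> mat_poly"
  where "top_component p = hom_component (total_degree p) p"


section \<open>Orbit harmonics\<close>

text \<open>Matrices are functions of the index pair \<open>(i, j)\<close>; only the entries with
  \<open>1 \<le> i, j \<le> n\<close> matter.\<close>

definition vanishing_ideal :: "nat \<Rightarrow> (nat \<times> nat \<Rightarrow> complex) set \<Rightarrow> mat_poly set"
  where "vanishing_ideal n Z =
    {p \<in> carrier (mat_poly_ring n). \<forall>A\<in>Z. poly_eval (\<lambda>c. c) A p = 0}"

definition gr_ideal :: "nat \<Rightarrow> mat_poly set \<Rightarrow> mat_poly set"
  where "gr_ideal n I = genideal (mat_poly_ring n) {top_component p | p. p \<in> I \<and> p \<noteq> 0}"

definition orbit_harmonics_ring :: "nat \<Rightarrow> (nat \<times> nat \<Rightarrow> complex) set \<Rightarrow> mat_poly set ring"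
  where "orbit_harmonics_ring n Z = mat_poly_ring n Quot gr_ideal n (vanishing_ideal n Z)"

text \<open>The degree \<open>d\<close> component consists of the cosets of the homogeneous polynomials of degree
  \<open>d\<close>. A scalar \<open>c\<close> acts as multiplication by the coset of the constant polynomial \<open>c\<close>, and
  a permutation \<open>g\<close> sends the coset of \<open>p\<close> to the coset of \<open>g \<cdot> p\<close>, which is the image of
  the former coset under \<open>g\<close>.\<close>

definition orbit_harmonics_component ::
    "nat \<Rightarrow> (nat \<times> nat \<Rightarrow> complex) set \<Rightarrow> nat \<Rightarrow> (complex, mat_poly set, nat \<Rightarrow> nat) rep"
  where "orbit_harmonics_component n Z d =
    (let P = mat_poly_ring n; I = gr_ideal n (vanishing_ideal n Z); R = orbit_harmonics_ring n Z
     in \<lparr>carrier = {I +>\<^bsub>P\<^esub> p | p. p \<in> carrier P \<and> homogeneous d p},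
         mult = mult R, one = one R, zero = zero R, add = add R,
         smult = (\<lambda>c A. (I +>\<^bsub>P\<^esub> Const c) \<otimes>\<^bsub>R\<^esub> A),
         act = (\<lambda>g A. poly_act g ` A)\<rparr>)"


section \<open>Involution matrices\<close>

definition involutions :: "nat \<Rightarrow> nat \<Rightarrow> (nat \<Rightarrow> nat) set"
  where "involutions n a =
    {w \<in> carrier (sym_group n). w \<circ> w = id \<and> card {i \<in> {1..n}. w i = i} = a}"

definition perm_matrix :: "nat \<Rightarrow> (nat \<Rightarrow> nat) \<Rightarrow> nat \<times> nat \<Rightarrow> complex"
  where "perm_matrix n w = (\<lambda>(i, j). of_bool (i \<in> {1..n} \<and> j \<in> {1..n} \<and> w i = j))"

definition involution_locus :: "nat \<Rightarrow> nat \<Rightarrow> (nat \<times> nat \<Rightarrow> complex) set"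
  where "involution_locus n a = perm_matrix n ` involutions n a"

end

theory Submission
  imports Defs
begin

text \<open>Let \<open>m = (n - a) / 2\<close> and identify an involution with the set \<open>N\<close> of its \<open>2\<close>-cycles, an
  \<open>m\<close>-matching of \<open>{1..n}\<close>. On the locus a polynomial of degree at most \<open>d\<close> becomes a function
  \<open>N \<mapsto> (\<Sum>M \<subseteq> N. c M)\<close> with \<open>c\<close> supported on matchings with at most \<open>d\<close> edges, where \<open>c\<close> does not
  depend on \<open>a\<close>. If \<open>d \<le> m\<close>, the functions of degree below \<open>d\<close> are the sums over the
  \<open>d\<close>-submatchings of the weights \<open>M \<mapsto> (\<Sum>e \<in> M. b (M - {e}))\<close>, a space of weights which is again
  independent of \<open>a\<close>. If moreover \<open>d \<le> a\<close>, a weight on the \<open>d\<close>-matchings is determined by its sums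
  over the \<open>d\<close>-submatchings of the \<open>m\<close>-matchings. Hence whether a form of degree \<open>d\<close> lies in the
  associated graded ideal does not depend on \<open>a\<close>, and mapping the coset of a form modulo one ideal
  to its coset modulo the other one is an isomorphism.\<close>

declare One_nat_def [simp del]

section \<open>Sums over submatchings\<close>

text \<open>Finiteness is stated separately because \<open>card\<close> is \<open>0\<close> on
  infinite sets: for infinite \<open>V\<close>, the condition \<open>card M = 0\<close> alone would
  admit infinite families.\<close>

definition matchings :: "'a set \<Rightarrow> nat \<Rightarrow> 'a set set set"
  where "matchings V k =
    {M. finite M \<and> M \<subseteq> Pow V \<and> (\<forall>e\<in>M. card e = 2) \<and> pairwise disjnt M \<and> card M = k}"

definition subset_sum :: "nat \<Rightarrow> ('a set \<Rightarrow> 'b::comm_monoid_add) \<Rightarrow> 'a set \<Rightarrow> 'b"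
  where "subset_sum k f N = (\<Sum>M | M \<subseteq> N \<and> card M = k. f M)"

lemma matchings_finite: "M \<in> matchings V k \<Longrightarrow> finite M"
  and matchings_card: "M \<in> matchings V k \<Longrightarrow> card M = k"
  by (auto simp: matchings_def)

lemma matchings_subset: "M \<in> matchings V k \<Longrightarrow> L \<subseteq> M \<Longrightarrow> L \<in> matchings V (card L)"
  unfolding matchings_def by (auto intro: finite_subset pairwise_subset)

lemma matchings_insert:
  assumes "L \<in> matchings W k" "W \<subseteq> V" "u \<in> V - W" "v \<in> V - W" "u \<noteq> v"
  shows "insert {u, v} L \<in> matchings V (Suc k)" and "{u, v} \<notin> L"
proof -
  show n: "{u, v} \<notin> L" using assms by (auto simp: matchings_def)
  show "insert {u, v} L \<in> matchings V (Suc k)"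
    using assms n by (auto simp: matchings_def pairwise_insert disjnt_def)
qed

lemma matchings_Diff:
  assumes "M \<in> matchings V (Suc k)" "e \<in> M"
  shows "M - {e} \<in> matchings (V - e) k"
proof -
  have "x \<inter> e = {}" if "x \<in> M - {e}" for x
    using assms that by (auto simp: matchings_def pairwise_def disjnt_def)
  moreover have "x \<subseteq> V" if "x \<in> M" for x using assms that by (auto simp: matchings_def)
  ultimately have "M - {e} \<subseteq> Pow (V - e)" by blast
  then show ?thesis
    using assms pairwise_subset[of disjnt M "M - {e}"] by (simp add: matchings_def)
qed

lemma card_Union_matching:
  assumes "M \<in> matchings V k"
  shows "card (\<Union>M) = 2 * k"
proof -
  have "card (\<Union>M) = sum card M"
    using assms by (intro card_Union_disjoint) (auto simp: matchings_def intro: card_ge_0_finite)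
  also have "\<dots> = 2 * k" using assms by (simp add: matchings_def)
  finally show ?thesis .
qed

lemma ex_matching:
  assumes "finite V" "2 * k \<le> card V"
  shows "\<exists>N. N \<in> matchings V k"
  using assms
proof (induction k arbitrary: V)
  case 0
  then show ?case by (auto simp: matchings_def intro!: exI[of _ "{}"])
next
  case (Suc k)
  obtain T where T: "T \<subseteq> V" "card T = 2"
    using obtain_subset_with_card_n[of 2 V] Suc.prems(2) by auto
  then obtain u v where uv: "T = {u, v}" "u \<noteq> v" by (auto simp: card_2_iff)
  have "card (V - T) = card V - 2" using T Suc.prems by (simp add: card_Diff_subset finite_subset)
  then have "2 * k \<le> card (V - T)" "finite (V - T)" using Suc.prems by auto
  then obtain N where "N \<in> matchings (V - T) k" using Suc.IH[of "V - T"] by blast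
  then have "insert {u, v} N \<in> matchings V (Suc k)"
    using matchings_insert(1)[of N "V - T" k V u v] uv T by auto
  then show ?case ..
qed

text \<open>Double counting of flags: a pair of \<open>M\<close> and \<open>e \<in> M\<close>
  corresponds to the pair of \<open>L = M - {e}\<close> and \<open>e \<in> N - L\<close>.\<close>

lemma subset_sum_Suc:
  assumes "finite N"
  shows "subset_sum (Suc k) (\<lambda>M. \<Sum>e\<in>M. g M e) N
    = subset_sum k (\<lambda>L. \<Sum>e\<in>N - L. g (insert e L) e) N"
proof -
  have fin: "finite L" if "L \<subseteq> N" for L using that assms by (rule finite_subset)
  have f1: "finite {M. M \<subseteq> N \<and> card M = k}" for k using assms by simp
  have "subset_sum (Suc k) (\<lambda>M. \<Sum>e\<in>M. g M e) N
     = (\<Sum>(M, e)\<in>(SIGMA M:{M. M \<subseteq> N \<and> card M = Suc k}. M). g M e)"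
    unfolding subset_sum_def by (intro sum.Sigma f1) (auto intro: fin)
  also have "\<dots> = (\<Sum>(L, e)\<in>(SIGMA L:{M. M \<subseteq> N \<and> card M = k}. N - L). g (insert e L) e)"
    by (rule sum.reindex_bij_witness[where i = "\<lambda>(L, e). (insert e L, e)" and j = "\<lambda>(M, e). (M - {e}, e)"])
      (auto simp: insert_absorb fin card_Diff_singleton_if)
  also have "\<dots> = subset_sum k (\<lambda>L. \<Sum>e\<in>N - L. g (insert e L) e) N"
    unfolding subset_sum_def by (intro sum.Sigma[symmetric] f1) (auto intro: assms)
  finally show ?thesis .
qed

text \<open>Each \<open>k\<close>-subset \<open>L\<close> of \<open>N\<close> arises as
  \<open>M - {e}\<close> once for every \<open>e \<in> N - L\<close>. The factor depends on
  \<open>N\<close> only through its size, so on sets of one fixed size above \<open>k\<close> a sum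
  over \<open>k\<close>-subsets can be rewritten as a sum over \<open>Suc k\<close>-subsets.\<close>

lemma subset_sum_raise:
  fixes b :: "'a set \<Rightarrow> 'b::field_char_0"
  assumes "finite N"
  shows "subset_sum (Suc k) (\<lambda>M. \<Sum>e\<in>M. b (M - {e})) N
    = of_nat (card N - k) * subset_sum k b N"
proof -
  have "subset_sum (Suc k) (\<lambda>M. \<Sum>e\<in>M. b (M - {e})) N
    = subset_sum k (\<lambda>L. \<Sum>e\<in>N - L. b (insert e L - {e})) N"
    by (rule subset_sum_Suc[OF assms])
  also have "\<dots> = (\<Sum>L | L \<subseteq> N \<and> card L = k. of_nat (card N - k) * b L)"
    unfolding subset_sum_def
    by (intro sum.cong) (auto simp: card_Diff_subset finite_subset[OF _ assms])
  finally show ?thesis by (simp add: subset_sum_def sum_distrib_left)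
qed

text \<open>The subsets of \<open>insert e N\<close> are split according to whether they contain
  \<open>e\<close>.\<close>

lemma subset_sum_insert:
  fixes f :: "'a set \<Rightarrow> 'b::comm_monoid_add"
  assumes "finite N" "e \<notin> N"
  shows "subset_sum (Suc k) f (insert e N) = subset_sum (Suc k) f N + subset_sum k (\<lambda>L. f (insert e L)) N"
proof -
  have fin: "finite L" if "L \<subseteq> N" for L using that assms(1) by (rule finite_subset)
  have "{M. M \<subseteq> insert e N \<and> card M = Suc k}
      = {M. M \<subseteq> N \<and> card M = Suc k} \<union> insert e ` {L. L \<subseteq> N \<and> card L = k}" (is "?A = ?B \<union> ?C")
  proof (intro equalityI subsetI)
    fix M assume M: "M \<in> ?A"
    show "M \<in> ?B \<union> ?C"
    proof (cases "e \<in> M")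
      case True
      have "finite M" using M assms(1) by (auto intro: finite_subset)
      then have "M - {e} \<in> {L. L \<subseteq> N \<and> card L = k}" using M True by auto
      moreover have "M = insert e (M - {e})" using True by (simp add: insert_absorb)
      ultimately show ?thesis by blast
    qed (use M in auto)
  next
    fix M assume "M \<in> ?B \<union> ?C"
    moreover have "card (insert e L) = Suc (card L)" if "L \<subseteq> N" for L
      using fin[OF that] that assms(2) by (subst card_insert_disjoint) auto
    ultimately show "M \<in> ?A" by auto
  qed
  moreover have "inj_on (insert e) {L. L \<subseteq> N \<and> card L = k}"
  proof (rule inj_onI)
    fix L L' assume "L \<in> {L. L \<subseteq> N \<and> card L = k}" "L' \<in> {L. L \<subseteq> N \<and> card L = k}" "insert e L = insert e L'"
    moreover from this have "e \<notin> L" "e \<notin> L'" using assms(2) by auto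
    ultimately show "L = L'" by (simp add: insert_ident)
  qed
  moreover have "?B \<inter> ?C = {}" using assms(2) by auto
  ultimately show ?thesis using assms(1) unfolding subset_sum_def
    by (simp add: sum.union_disjoint sum.reindex)
qed

text \<open>Comparing the sums over \<open>N \<union> {uv}\<close> and \<open>N \<union> {up}\<close>, where \<open>N\<close> avoids \<open>u\<close>, \<open>v\<close> and \<open>p\<close>,
  the induction hypothesis shows that the value of \<open>f\<close> does not change when one edge of its
  argument moves. So \<open>f M = h (M - {e})\<close> for all \<open>e \<in> M\<close>, and the induction hypothesis
  applies to \<open>h\<close>.\<close>

lemma subset_sum_matchings_inj:
  fixes f :: "'a set set \<Rightarrow> 'b::field_char_0"
  assumes "finite V" "k \<le> m" "2 * m + k \<le> card V"
    and "\<And>N. N \<in> matchings V m \<Longrightarrow> subset_sum k f N = 0"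
    and "M \<in> matchings V k"
  shows "f M = 0"
  using assms
proof (induction k arbitrary: V m f M)
  case 0
  from ex_matching[OF 0(1), of m] 0 obtain N where N: "N \<in> matchings V m" by auto
  have "{M. M \<subseteq> N \<and> card M = 0} = {{}}" using matchings_finite[OF N] by (auto dest: finite_subset)
  then have "f {} = 0" using 0(4)[OF N] by (simp add: subset_sum_def)
  moreover have "M = {}" using 0(5) by (auto simp: matchings_def)
  ultimately show ?case by simp
next
  case (Suc k)
  obtain m' where m: "m = Suc m'" using Suc.prems by (cases m) auto
  have swap: "f (insert {u, v} L) = f (insert {u, p} L)"
    if "u \<in> V" "v \<in> V" "p \<in> V" "u \<noteq> v" "u \<noteq> p" "v \<noteq> p" "L \<in> matchings (V - {u, v, p}) k" for u v p L
  proof -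
    let ?W = "V - {u, v, p}"
    let ?g = "\<lambda>L. f (insert {u, v} L) - f (insert {u, p} L)"
    have cW: "card ?W = card V - 3" using that Suc.prems(1) by (subst card_Diff_subset) auto
    have "?g L = 0"
    proof (rule Suc.IH[where V = ?W and m = m' and M = L])
      \<comment> \<open>The inequality \<open>2 * m + Suc k \<le> card V\<close> loses three on both
        sides: two for the edge taken from \<open>m\<close> and one for \<open>k\<close> on the
        left, the points \<open>u\<close>, \<open>v\<close>, \<open>p\<close> on the right.\<close>
      show "finite ?W" "k \<le> m'" "2 * m' + k \<le> card ?W" using Suc.prems cW m by auto
      show "L \<in> matchings ?W k" by fact
      fix N assume N: "N \<in> matchings ?W m'"
      have uv: "{u, v} \<notin> N" "insert {u, v} N \<in> matchings V m"
        using matchings_insert[OF N, of V u v] that m by auto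
      have up: "{u, p} \<notin> N" "insert {u, p} N \<in> matchings V m"
        using matchings_insert[OF N, of V u p] that m by auto
      show "subset_sum k ?g N = 0"
      proof -
        have "subset_sum k (\<lambda>L. f (insert {u, v} L)) N = - subset_sum (Suc k) f N"
          "subset_sum k (\<lambda>L. f (insert {u, p} L)) N = - subset_sum (Suc k) f N"
          using Suc.prems(4)[OF uv(2)] Suc.prems(4)[OF up(2)]
            subset_sum_insert[OF matchings_finite[OF N] uv(1), of k f]
            subset_sum_insert[OF matchings_finite[OF N] up(1), of k f]
          by (simp_all add: eq_neg_iff_add_eq_0 add.commute)
        then show ?thesis by (simp add: subset_sum_def sum_subtractf)
      qed
    qed
    then show ?thesis by simp
  qed
  have move: "f (insert e L) = f (insert e' L)"
    if "insert e L \<in> matchings V (Suc k)" "insert e' L \<in> matchings V (Suc k)" "e \<notin> L" "e' \<notin> L" for e e' L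
  proof -
    have ee: "card e = 2" "card e' = 2" "e \<subseteq> V" "e' \<subseteq> V" using that by (simp_all add: matchings_def)
    obtain u v where e: "e = {u, v}" "u \<noteq> v" using ee(1) by (auto simp: card_2_iff)
    obtain x y where e': "e' = {x, y}" "x \<noteq> y" using ee(2) by (auto simp: card_2_iff)
    have V: "{u, v, x, y} \<subseteq> V" using ee e e' by simp
    have L: "L \<in> matchings (V - {u, v, x, y}) k"
    proof -
      have *: "L \<in> matchings (V - e) k" "L \<in> matchings (V - e') k"
        using matchings_Diff[OF that(1), of e] matchings_Diff[OF that(2), of e'] that(3,4) by simp_all
      then have "L \<subseteq> Pow (V - e) \<inter> Pow (V - e')" by (simp add: matchings_def)
      also have "\<dots> \<subseteq> Pow (V - {u, v, x, y})" unfolding e e' by auto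
      finally show ?thesis using *(1) by (simp add: matchings_def)
    qed
    then have sub: "L \<in> matchings (V - T) k" if "T \<subseteq> {u, v, x, y}" for T
      using that unfolding matchings_def by blast
    have adj: "f (insert {a, b} L) = f (insert {a, c} L)"
      if "{a, b, c} \<subseteq> {u, v, x, y}" "a \<noteq> b" "a \<noteq> c" for a b c
    proof (cases "b = c")
      case False
      have "a \<in> V" "b \<in> V" "c \<in> V" using that(1) V by blast+
      then show ?thesis using swap[of a b c L] sub[OF that(1)] that(2,3) False by simp
    qed simp
    \<comment> \<open>Edges without a common endpoint at \<open>u = x\<close> are joined through the
      intermediate edge \<open>{x, u}\<close>: first \<open>v\<close> is exchanged for
      \<open>x\<close>, then \<open>u\<close> for \<open>y\<close>. All edges involved avoid the
      points covered by \<open>L\<close>.\<close>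
    show ?thesis
    proof (cases "u = x")
      case True
      then show ?thesis using adj[of u v y] e e' by simp
    next
      case False
      then have "f (insert {u, v} L) = f (insert {x, u} L)" using adj[of u v x] e e' by (simp add: insert_commute)
      also have "\<dots> = f (insert {x, y} L)" using adj[of x u y] False e e' by simp
      finally show ?thesis using e e' by simp
    qed
  qed
  \<comment> \<open>Any edge that completes \<open>L\<close> to a matching may be chosen, since
    \<open>move\<close> makes the value of \<open>f\<close> independent of the choice.\<close>
  define h where "h = (\<lambda>L. f (insert (SOME e. e \<notin> L \<and> insert e L \<in> matchings V (Suc k)) L))"
  have h: "h L = f (insert e L)" if "e \<notin> L" "insert e L \<in> matchings V (Suc k)" for e L
    unfolding h_def
    using someI[where P = "\<lambda>e. e \<notin> L \<and> insert e L \<in> matchings V (Suc k)", OF conjI, OF that]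
    by (intro move) (use that in blast)+
  have hf: "f M' = h (M' - {e})" if "M' \<in> matchings V (Suc k)" "e \<in> M'" for M' e
    using h[of e "M' - {e}"] that by (simp add: insert_absorb)
  have h0: "h L = 0" if "L \<in> matchings V k" for L
  proof (rule Suc.IH[where V = V and m = m and M = L])
    fix N assume N: "N \<in> matchings V m"
    note fin = matchings_finite[OF N]
    \<comment> \<open>On a \<open>Suc k\<close>-submatching \<open>M\<close> all terms
      \<open>h (M - {e})\<close> equal \<open>f M\<close>, so the vanishing sums of \<open>f\<close>
      give vanishing sums of \<open>h\<close>. The factor \<open>card N - k\<close> can be cancelled
      because \<open>Suc k \<le> m\<close>.\<close>
    have "of_nat (card N - k) * subset_sum k h N
       = subset_sum (Suc k) (\<lambda>M. \<Sum>e\<in>M. h (M - {e})) N"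
      by (rule subset_sum_raise[OF fin, symmetric])
    also have "\<dots> = (\<Sum>M | M \<subseteq> N \<and> card M = Suc k. of_nat (Suc k) * f M)"
      unfolding subset_sum_def
    proof (intro sum.cong refl)
      fix M assume M: "M \<in> {M. M \<subseteq> N \<and> card M = Suc k}"
      then have "M \<in> matchings V (Suc k)" using matchings_subset[OF N, of M] by auto
      then have "(\<Sum>e\<in>M. h (M - {e})) = (\<Sum>e\<in>M. f M)" by (intro sum.cong) (auto simp: hf[symmetric])
      then show "(\<Sum>e\<in>M. h (M - {e})) = of_nat (Suc k) * f M" using M by simp
    qed
    also have "\<dots> = 0" using Suc.prems(4)[OF N] by (simp add: subset_sum_def sum_distrib_left[symmetric])
    finally show "subset_sum k h N = 0" using Suc.prems(2) matchings_card[OF N] by auto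
  qed (use Suc.prems that in auto)
  obtain e where e: "e \<in> M" using Suc.prems(5) by (auto simp: matchings_def card_Suc_eq)
  have "M - {e} \<in> matchings V k" using matchings_subset[OF Suc.prems(5), of "M - {e}"] e Suc.prems(5)
    by (simp add: matchings_def)
  then show ?case using hf[OF Suc.prems(5) e] h0 by simp
qed

section \<open>Evaluation and homogeneous components\<close>

text \<open>A polynomial is the finite sum of its terms, so claims that are additive in it need
  checking on single terms only. Zero needs no case of its own, being a term with coefficient
  \<open>0\<close>.\<close>

lemma single_induct [case_names single add]:
  fixes p :: "'a::zero \<Rightarrow>\<^sub>0 'b::comm_monoid_add"
  assumes "\<And>m c. P (Poly_Mapping.single m c)" and "\<And>p q. P p \<Longrightarrow> P q \<Longrightarrow> P (p + q)"
  shows "P p"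
proof -
  have "P (\<Sum>m\<in>A. Poly_Mapping.single m (Poly_Mapping.lookup p m))" if "finite A" for A
    using that
  proof (induction A)
    case empty
    show ?case using assms(1)[of 0 0] by simp
  qed (simp add: assms)
  moreover have "p = (\<Sum>m\<in>Poly_Mapping.keys p. Poly_Mapping.single m (Poly_Mapping.lookup p m))"
    by (rule poly_mapping_eqI)
      (auto simp: lookup_sum lookup_single when_def not_in_keys_iff_lookup_eq_zero)
  ultimately show ?thesis by (metis finite_keys)
qed

lemma Const_mult_single: "Const a * Poly_Mapping.single m c = Poly_Mapping.single m (a * c)"
  by (simp add: Const_def mult_single)

lemma single_add_Var: "Poly_Mapping.single (m + Poly_Mapping.single v 1) c = Poly_Mapping.single m c * Var v"
  by (simp add: Var_def mult_single)

section \<open>The polynomial ring and induction over its elements\<close>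

lemma mat_poly_carrier:
  "p \<in> carrier (mat_poly_ring n) \<longleftrightarrow>
    (\<forall>m\<in>Poly_Mapping.keys p. Poly_Mapping.keys m \<subseteq> {1..n} \<times> {1..n})"
  by (simp add: mat_poly_ring_def)

lemma mat_poly_ring_simps [simp]:
  "mult (mat_poly_ring n) = (*)" "one (mat_poly_ring n) = 1"
  "zero (mat_poly_ring n) = 0" "add (mat_poly_ring n) = (+)"
  by (simp_all add: mat_poly_ring_def)

lemma carrier_zero [simp]: "0 \<in> carrier (mat_poly_ring n)"
  and carrier_one [simp]: "1 \<in> carrier (mat_poly_ring n)"
  and carrier_Const [simp]: "Const c \<in> carrier (mat_poly_ring n)"
  and carrier_Var: "v \<in> {1..n} \<times> {1..n} \<Longrightarrow> Var v \<in> carrier (mat_poly_ring n)"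
  by (auto simp: mat_poly_carrier Const_def Var_def)

lemma carrier_add [simp]:
  "p \<in> carrier (mat_poly_ring n) \<Longrightarrow> q \<in> carrier (mat_poly_ring n) \<Longrightarrow> p + q \<in> carrier (mat_poly_ring n)"
  unfolding mat_poly_carrier using keys_add[of p q] by blast

lemma carrier_uminus [simp]: "p \<in> carrier (mat_poly_ring n) \<Longrightarrow> - p \<in> carrier (mat_poly_ring n)"
  unfolding mat_poly_carrier by (auto simp: in_keys_iff)

lemma carrier_diff [simp]:
  "p \<in> carrier (mat_poly_ring n) \<Longrightarrow> q \<in> carrier (mat_poly_ring n) \<Longrightarrow> p - q \<in> carrier (mat_poly_ring n)"
  using carrier_add[of p n "- q"] by simp

lemma carrier_mult [simp]:
  assumes "p \<in> carrier (mat_poly_ring n)" "q \<in> carrier (mat_poly_ring n)"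
  shows "p * q \<in> carrier (mat_poly_ring n)"
  unfolding mat_poly_carrier
proof
  fix m assume "m \<in> Poly_Mapping.keys (p * q)"
  then obtain a b where ab: "m = a + b" "a \<in> Poly_Mapping.keys p" "b \<in> Poly_Mapping.keys q"
    using keys_mult[of p q] by blast
  then show "Poly_Mapping.keys m \<subseteq> {1..n} \<times> {1..n}"
    using assms keys_add[of a b] unfolding mat_poly_carrier by blast
qed

lemma carrier_sum:
  "(\<And>i. i \<in> A \<Longrightarrow> f i \<in> carrier (mat_poly_ring n)) \<Longrightarrow> sum f A \<in> carrier (mat_poly_ring n)"
  by (induction A rule: infinite_finite_induct) auto

lemma mat_poly_cring: "cring (mat_poly_ring n)"
  by (intro cringI abelian_groupI comm_monoidI)
    (auto simp: algebra_simps intro!: bexI[of _ "- x" for x])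

text \<open>Variables are peeled off a monomial one at a time, by induction on its degree.
  Compatibility with evaluation, with the action and with the grading is thereby reduced to
  constants and multiplication by one variable.\<close>

lemma carrier_induct [consumes 1, case_names Const Var add]:
  assumes "p \<in> carrier (mat_poly_ring n)"
    and Const: "\<And>c. P (Const c)"
    and Var: "\<And>p v. p \<in> carrier (mat_poly_ring n) \<Longrightarrow> P p \<Longrightarrow> v \<in> {1..n} \<times> {1..n} \<Longrightarrow> P (p * Var v)"
    and add: "\<And>p q. p \<in> carrier (mat_poly_ring n) \<Longrightarrow> q \<in> carrier (mat_poly_ring n)
      \<Longrightarrow> P p \<Longrightarrow> P q \<Longrightarrow> P (p + q)"
  shows "P p"
proof -
  let ?C = "carrier (mat_poly_ring n)"
  have single: "P (Poly_Mapping.single m c)" if "Poly_Mapping.keys m \<subseteq> {1..n} \<times> {1..n}" for m c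
    using that
  proof (induction "mon_degree m" arbitrary: m rule: less_induct)
    case less
    show ?case
    proof (cases "m = 0")
      case True
      then show ?thesis using Const[of c] by (simp add: Const_def)
    next
      case False
      then have "Poly_Mapping.keys m \<noteq> {}"
        by (metis in_keys_iff empty_iff lookup_zero poly_mapping_eqI)
      then obtain v where v: "v \<in> Poly_Mapping.keys m" by blast
      define m' where "m' = m - Poly_Mapping.single v 1"
      have l: "Poly_Mapping.lookup m u = Poly_Mapping.lookup m' u + (1 when v = u)" for u
        using v by (auto simp: m'_def lookup_minus lookup_single when_def in_keys_iff)
      have m: "m = m' + Poly_Mapping.single v 1"
        by (rule poly_mapping_eqI) (simp add: l lookup_add lookup_single)
      have sub: "Poly_Mapping.keys m' \<subseteq> Poly_Mapping.keys m"
        by (auto simp: in_keys_iff l)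
      have "mon_degree m' = (\<Sum>u\<in>Poly_Mapping.keys m. Poly_Mapping.lookup m' u)"
        unfolding mon_degree_def by (rule sum.mono_neutral_left) (use sub in \<open>auto simp: in_keys_iff\<close>)
      also have "\<dots> < mon_degree m"
        unfolding mon_degree_def by (rule sum_strict_mono_ex1) (use v l in \<open>auto simp: when_def\<close>)
      finally have "P (Poly_Mapping.single m' c)" using less sub by blast
      moreover have "Poly_Mapping.single m' c \<in> ?C" using less.prems sub by (auto simp: mat_poly_carrier)
      ultimately show ?thesis unfolding m single_add_Var using Var v less.prems by blast
    qed
  qed
  have "(\<Sum>m\<in>A. Poly_Mapping.single m (Poly_Mapping.lookup p m)) \<in> ?C
      \<and> P (\<Sum>m\<in>A. Poly_Mapping.single m (Poly_Mapping.lookup p m))"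
    if "A \<subseteq> Poly_Mapping.keys p" for A
    using finite_subset[OF that finite_keys] that
  proof (induction A)
    case empty
    show ?case using Const[of 0] by (simp add: Const_def)
  next
    case (insert m A)
    then have "Poly_Mapping.keys m \<subseteq> {1..n} \<times> {1..n}" using assms(1) by (auto simp: mat_poly_carrier)
    moreover from this have "Poly_Mapping.single m (Poly_Mapping.lookup p m) \<in> ?C" by (auto simp: mat_poly_carrier)
    ultimately show ?case using insert add single by simp
  qed
  moreover have "p = (\<Sum>m\<in>Poly_Mapping.keys p. Poly_Mapping.single m (Poly_Mapping.lookup p m))"
    by (rule poly_mapping_eqI)
      (auto simp: lookup_sum lookup_single when_def not_in_keys_iff_lookup_eq_zero)
  ultimately show ?thesis by (metis order_refl)
qed

text \<open>Treats both uses of \<open>poly_eval\<close> at once: the identity on coefficients gives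
  evaluation at a matrix, \<open>Const\<close> gives the substitution of variables behind
  \<open>poly_act\<close>.\<close>

locale coeff_hom =
  fixes h :: "complex \<Rightarrow> 'a::comm_ring_1"
  assumes zero: "h 0 = 0" and one: "h 1 = 1"
    and add: "h (a + b) = h a + h b" and mult: "h (a * b) = h a * h b"
begin

lemma poly_eval_superset:
  assumes "finite K" "Poly_Mapping.keys p \<subseteq> K"
  shows "poly_eval h x p = (\<Sum>m\<in>K. h (Poly_Mapping.lookup p m) *
      (\<Prod>v\<in>Poly_Mapping.keys m. x v ^ Poly_Mapping.lookup m v))"
  unfolding poly_eval_def
  by (rule sum.mono_neutral_left) (use assms in \<open>auto simp: in_keys_iff zero\<close>)

lemma poly_eval_add: "poly_eval h x (p + q) = poly_eval h x p + poly_eval h x q"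
proof -
  have K: "finite (Poly_Mapping.keys p \<union> Poly_Mapping.keys q)" by simp
  show ?thesis
    using keys_add[of p q]
    by (simp add: poly_eval_superset[OF K] lookup_add add distrib_right sum.distrib)
qed

lemma poly_eval_single: "poly_eval h x (Poly_Mapping.single m a)
    = h a * (\<Prod>v\<in>Poly_Mapping.keys m. x v ^ Poly_Mapping.lookup m v)"
  by (subst poly_eval_superset[where K = "{m}"]) auto

lemma poly_eval_Const: "poly_eval h x (Const a) = h a"
  by (simp add: Const_def poly_eval_single)

lemma poly_eval_Var: "poly_eval h x (Var v) = x v"
  by (simp add: Var_def poly_eval_single one)

lemma poly_eval_one: "poly_eval h x 1 = 1"
  using poly_eval_Const[of x 1] by (simp add: Const_def one)

lemma poly_eval_zero: "poly_eval h x 0 = 0"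
  by (simp add: poly_eval_def)

lemma monomial_eval_add:
  fixes m m' :: monomial
  shows "(\<Prod>v\<in>Poly_Mapping.keys (m + m'). x v ^ Poly_Mapping.lookup (m + m') v)
    = (\<Prod>v\<in>Poly_Mapping.keys m. x v ^ Poly_Mapping.lookup m v)
    * (\<Prod>v\<in>Poly_Mapping.keys m'. (x v :: 'a) ^ Poly_Mapping.lookup m' v)"
proof -
  let ?K = "Poly_Mapping.keys m \<union> Poly_Mapping.keys m'"
  have *: "(\<Prod>v\<in>Poly_Mapping.keys k. x v ^ Poly_Mapping.lookup k v)
      = (\<Prod>v\<in>?K. x v ^ Poly_Mapping.lookup k v)" if "Poly_Mapping.keys k \<subseteq> ?K" for k
    by (rule prod.mono_neutral_left) (use that in \<open>auto simp: in_keys_iff\<close>)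
  show ?thesis
    using *[OF keys_add] *[of m] *[of m'] by (simp add: lookup_add power_add prod.distrib)
qed

lemma poly_eval_mult: "poly_eval h x (p * q) = poly_eval h x p * poly_eval h x q"
proof (induction p rule: single_induct)
  case (single m a)
  show ?case
  proof (induction q rule: single_induct)
    case (single m' b)
    show ?case by (simp add: mult_single poly_eval_single monomial_eval_add mult mult_ac)
  qed (simp add: poly_eval_add algebra_simps)
qed (simp add: poly_eval_add algebra_simps)

lemma poly_eval_sum: "poly_eval h x (\<Sum>i\<in>A. f i) = (\<Sum>i\<in>A. poly_eval h x (f i))"
  by (induction A rule: infinite_finite_induct) (auto simp: poly_eval_add poly_eval_zero)

lemma poly_eval_prod: "poly_eval h x (\<Prod>i\<in>A. f i) = (\<Prod>i\<in>A. poly_eval h x (f i))"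
  by (induction A rule: infinite_finite_induct) (auto simp: poly_eval_mult poly_eval_one)

lemma poly_eval_uminus: "poly_eval h x (- p) = - poly_eval h x p"
  using poly_eval_add[of x p "- p"] by (simp add: poly_eval_zero eq_neg_iff_add_eq_0 add.commute)

lemma poly_eval_diff: "poly_eval h x (p - q) = poly_eval h x p - poly_eval h x q"
  using poly_eval_add[of x p "- q"] by (simp add: poly_eval_uminus)

end

interpretation eval: coeff_hom "\<lambda>c. c"
  by standard auto

interpretation act: coeff_hom Const
  by standard (auto simp: Const_def single_add mult_single)

section \<open>The action of permutations on polynomials\<close>

lemma poly_act_Const [simp]: "poly_act g (Const a) = Const a"
  and poly_act_Var [simp]: "poly_act g (Var v) = Var (map_prod g g v)"
  and poly_act_add: "poly_act g (p + q) = poly_act g p + poly_act g q"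
  and poly_act_mult: "poly_act g (p * q) = poly_act g p * poly_act g q"
  by (simp_all add: poly_act_def act.poly_eval_add act.poly_eval_mult act.poly_eval_Const act.poly_eval_Var map_prod_def split: prod.split)

context
  fixes n :: nat and g :: "nat \<Rightarrow> nat"
  assumes g: "g permutes {1..n}"
begin

lemma map_prod_permutes: "v \<in> {1..n} \<times> {1..n} \<Longrightarrow> map_prod g g v \<in> {1..n} \<times> {1..n}"
  using permutes_in_image[OF g] by (auto simp del: atLeastAtMost_iff)

lemma poly_act_closed:
  assumes "p \<in> carrier (mat_poly_ring n)"
  shows "poly_act g p \<in> carrier (mat_poly_ring n)"
  using assms
proof (induction rule: carrier_induct)
  case (Var p v)
  then show ?case using carrier_Var[OF map_prod_permutes[of v]] by (simp add: poly_act_mult)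
qed (simp_all add: poly_act_add)

text \<open>The action on polynomials is dual to reindexing matrices. Hence a locus stable under
  reindexing has a stable vanishing ideal.\<close>

lemma poly_eval_poly_act:
  assumes "p \<in> carrier (mat_poly_ring n)"
  shows "poly_eval (\<lambda>c. c) A (poly_act g p) = poly_eval (\<lambda>c. c) (A \<circ> map_prod g g) p"
  using assms
  by (induction rule: carrier_induct)
    (simp_all add: poly_act_add poly_act_mult eval.poly_eval_Const eval.poly_eval_Var eval.poly_eval_add eval.poly_eval_mult)

end

lemma poly_act_comp:
  assumes "p \<in> carrier (mat_poly_ring n)"
  shows "poly_act (g \<circ> h) p = poly_act g (poly_act h p)"
  using assms by (induction rule: carrier_induct) (simp_all add: poly_act_add poly_act_mult map_prod.compositionality o_def)

lemma poly_act_id: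
  assumes "p \<in> carrier (mat_poly_ring n)"
  shows "poly_act id p = p"
  using assms by (induction rule: carrier_induct) (simp_all add: poly_act_add poly_act_mult map_prod.identity)

section \<open>The grading by total degree\<close>

lemma lookup_hom_component:
  "Poly_Mapping.lookup (hom_component d p) m = (Poly_Mapping.lookup p m when mon_degree m = d)"
  by (auto simp: hom_component_def lookup_sum lookup_single when_def not_in_keys_iff_lookup_eq_zero)

lemma hom_component_zero [simp]: "hom_component d 0 = 0"
  by (simp add: poly_mapping_eq_iff fun_eq_iff lookup_hom_component)

lemma hom_component_add: "hom_component d (p + q) = hom_component d p + hom_component d q"
  by (rule poly_mapping_eqI) (auto simp: lookup_hom_component lookup_add when_def)

lemma hom_component_uminus: "hom_component d (- p) = - hom_component d p"
  by (rule poly_mapping_eqI) (auto simp: lookup_hom_component when_def)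

lemma hom_component_diff: "hom_component d (p - q) = hom_component d p - hom_component d q"
  by (rule poly_mapping_eqI) (auto simp: lookup_hom_component lookup_minus when_def)

lemma hom_component_single:
  "hom_component d (Poly_Mapping.single m c) = (if mon_degree m = d then Poly_Mapping.single m c else 0)"
  by (rule poly_mapping_eqI) (auto simp: lookup_hom_component lookup_single when_def)

lemma mon_degree_zero [simp]: "mon_degree 0 = 0"
  by (simp add: mon_degree_def)

lemma mon_degree_add: "mon_degree (m + m') = mon_degree m + mon_degree m'"
proof -
  let ?K = "Poly_Mapping.keys m \<union> Poly_Mapping.keys m'"
  have *: "mon_degree k = (\<Sum>v\<in>?K. Poly_Mapping.lookup k v)" if "Poly_Mapping.keys k \<subseteq> ?K" for k
    unfolding mon_degree_def by (rule sum.mono_neutral_left) (use that in \<open>auto simp: in_keys_iff\<close>)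
  show ?thesis using *[OF keys_add] *[of m] *[of m'] by (simp add: lookup_add sum.distrib)
qed

lemma mon_degree_single [simp]: "mon_degree (Poly_Mapping.single v k) = k"
  by (simp add: mon_degree_def)

lemma hom_component_Const: "hom_component d (Const c) = (if d = 0 then Const c else 0)"
  by (simp add: Const_def hom_component_single)

lemma hom_component_mult_Var:
  "hom_component d (p * Var v) = (case d of 0 \<Rightarrow> 0 | Suc k \<Rightarrow> hom_component k p * Var v)"
  by (induction p rule: single_induct)
    (auto simp: distrib_right hom_component_add single_add_Var[symmetric] hom_component_single
      mon_degree_add split: nat.splits)

lemma hom_component_Const_mult: "hom_component d (Const a * p) = Const a * hom_component d p"
  by (induction p rule: single_induct)
    (auto simp: distrib_left hom_component_add hom_component_single Const_mult_single)

lemma hom_component_carrier [simp]: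
  "p \<in> carrier (mat_poly_ring n) \<Longrightarrow> hom_component d p \<in> carrier (mat_poly_ring n)"
  by (auto simp: mat_poly_carrier in_keys_iff lookup_hom_component when_def split: if_splits)

lemma hom_component_homogeneous:
  assumes "homogeneous d p"
  shows "hom_component k p = (if k = d then p else 0)"
  using assms
  by (intro poly_mapping_eqI) (auto simp: lookup_hom_component homogeneous_def when_def in_keys_iff)

lemma homogeneous_iff: "homogeneous d p \<longleftrightarrow> hom_component d p = p"
  by (auto simp: poly_mapping_eq_iff fun_eq_iff lookup_hom_component homogeneous_def when_def in_keys_iff)

lemma homogeneous_hom_component [simp]: "homogeneous d (hom_component d p)"
  by (auto simp: homogeneous_def in_keys_iff lookup_hom_component when_def split: if_splits)

lemma sum_hom_component:
  assumes "\<And>k. k \<ge> D \<Longrightarrow> hom_component k p = 0"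
  shows "p = (\<Sum>k<D. hom_component k p)"
proof (rule poly_mapping_eqI)
  fix m
  have "Poly_Mapping.lookup p m = 0" if "mon_degree m \<ge> D"
    using arg_cong[OF assms[OF that], of "\<lambda>q. Poly_Mapping.lookup q m"] by (simp add: lookup_hom_component)
  then show "Poly_Mapping.lookup p m = Poly_Mapping.lookup (\<Sum>k<D. hom_component k p) m"
    by (cases "mon_degree m < D") (auto simp: lookup_sum lookup_hom_component when_def)
qed

lemma ex_degree_bound: "\<exists>D. \<forall>k\<ge>D. hom_component k p = 0"
proof (induction p rule: single_induct)
  case (single m c)
  show ?case by (rule exI[of _ "Suc (mon_degree m)"]) (auto simp: hom_component_single)
next
  case (add p q)
  then obtain D E where "\<forall>k\<ge>D. hom_component k p = 0" "\<forall>k\<ge>E. hom_component k q = 0" by blast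
  then show ?case by (intro exI[of _ "max D E"]) (auto simp: hom_component_add)
qed

lemma hom_component_poly_act:
  assumes "g permutes {1..n}" "p \<in> carrier (mat_poly_ring n)"
  shows "hom_component d (poly_act g p) = poly_act g (hom_component d p)"
  using assms(2)
proof (induction arbitrary: d rule: carrier_induct)
  case (Const c)
  have "poly_act g 0 = 0" using poly_act_Const[of g 0] by (simp add: Const_def)
  then show ?case by (simp add: hom_component_Const)
next
  case (Var p v)
  have "poly_act g 0 = 0" using poly_act_Const[of g 0] by (simp add: Const_def)
  then show ?case by (cases d) (simp_all add: poly_act_mult hom_component_mult_Var Var)
next
  case (add p q)
  then show ?case by (simp add: poly_act_add hom_component_add)
qed

lemma total_degree_bound:
  assumes "p \<noteq> 0" "k > total_degree p"
  shows "hom_component k p = 0"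
proof (rule poly_mapping_eqI)
  fix m
  have "mon_degree m \<le> total_degree p" if "m \<in> Poly_Mapping.keys p"
    unfolding total_degree_def using that by (intro Max_ge) auto
  then show "Poly_Mapping.lookup (hom_component k p) m = Poly_Mapping.lookup 0 m"
    using assms(2) by (force simp: lookup_hom_component when_def in_keys_iff)
qed

text \<open>Recognises the top component from a degree bound that is attained, without computing the
  maximum in \<open>total_degree\<close>.\<close>

lemma top_component_eq:
  assumes "\<And>k. k > d \<Longrightarrow> hom_component k p = 0" "hom_component d p \<noteq> 0"
  shows "top_component p = hom_component d p"
proof -
  have p: "p \<noteq> 0" using assms(2) by auto
  then have "Poly_Mapping.keys p \<noteq> {}"
    by (metis in_keys_iff empty_iff lookup_zero poly_mapping_eqI)
  then have "total_degree p \<in> mon_degree ` Poly_Mapping.keys p" by (simp add: total_degree_def)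
  then obtain m where "m \<in> Poly_Mapping.keys p" "mon_degree m = total_degree p" by (metis imageE)
  then have "Poly_Mapping.lookup (hom_component (total_degree p) p) m \<noteq> 0"
    by (simp add: lookup_hom_component in_keys_iff)
  then have "\<not> total_degree p > d" using assms(1) by fastforce
  moreover have "\<not> d > total_degree p" using total_degree_bound[OF p] assms(2) by blast
  ultimately show ?thesis by (simp add: top_component_def)
qed

section \<open>The associated graded ideal and its quotient\<close>

lemma homogeneous_zero [simp]: "homogeneous d 0"
  by (simp add: homogeneous_iff)

lemma homogeneous_add: "homogeneous d p \<Longrightarrow> homogeneous d q \<Longrightarrow> homogeneous d (p + q)"
  by (simp add: homogeneous_iff hom_component_add)

lemma homogeneous_uminus: "homogeneous d p \<Longrightarrow> homogeneous d (- p)"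
  by (simp add: homogeneous_iff hom_component_uminus)

lemma homogeneous_diff: "homogeneous d p \<Longrightarrow> homogeneous d q \<Longrightarrow> homogeneous d (p - q)"
  by (simp add: homogeneous_iff hom_component_diff)

lemma homogeneous_Const_mult: "homogeneous d p \<Longrightarrow> homogeneous d (Const a * p)"
  by (simp add: homogeneous_iff hom_component_Const_mult)

lemma homogeneous_poly_act:
  "g permutes {1..n} \<Longrightarrow> p \<in> carrier (mat_poly_ring n) \<Longrightarrow> homogeneous d p \<Longrightarrow> homogeneous d (poly_act g p)"
  by (simp add: homogeneous_iff hom_component_poly_act)

text \<open>The degree \<open>d\<close> part of the associated graded ideal, as
  \<open>gr_ideal_homogeneous\<close> confirms. Elements of degree at most \<open>d\<close> are
  allowed instead of exactly \<open>d\<close>, so that zero is included and sums whose top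
  components cancel cause no case distinction.\<close>

definition leading_forms :: "nat \<Rightarrow> (nat \<times> nat \<Rightarrow> complex) set \<Rightarrow> nat \<Rightarrow> mat_poly set"
  where "leading_forms n Z d =
    {hom_component d r | r. r \<in> vanishing_ideal n Z \<and> (\<forall>k>d. hom_component k r = 0)}"

lemma leading_forms_zero: "0 \<in> leading_forms n Z d"
  unfolding leading_forms_def
  by (intro CollectI exI[of _ 0]) (simp add: vanishing_ideal_def eval.poly_eval_zero)

lemma leading_forms_add:
  assumes "p \<in> leading_forms n Z d" "q \<in> leading_forms n Z d"
  shows "p + q \<in> leading_forms n Z d"
proof -
  obtain r s where "p = hom_component d r" "r \<in> vanishing_ideal n Z" "\<forall>k>d. hom_component k r = 0"
    and "q = hom_component d s" "s \<in> vanishing_ideal n Z" "\<forall>k>d. hom_component k s = 0"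
    using assms by (auto simp: leading_forms_def)
  then show ?thesis unfolding leading_forms_def
    by (intro CollectI exI[of _ "r + s"]) (simp add: vanishing_ideal_def eval.poly_eval_add hom_component_add)
qed

lemma leading_forms_Const_mult:
  assumes "p \<in> leading_forms n Z d"
  shows "Const a * p \<in> leading_forms n Z d"
proof -
  obtain r where "p = hom_component d r" "r \<in> vanishing_ideal n Z" "\<forall>k>d. hom_component k r = 0"
    using assms by (auto simp: leading_forms_def)
  then show ?thesis unfolding leading_forms_def
    by (intro CollectI exI[of _ "Const a * r"])
      (simp add: vanishing_ideal_def eval.poly_eval_mult hom_component_Const_mult)
qed

lemma leading_forms_mult_Var:
  assumes "p \<in> leading_forms n Z d" "v \<in> {1..n} \<times> {1..n}"
  shows "p * Var v \<in> leading_forms n Z (Suc d)"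
proof -
  obtain r where "p = hom_component d r" "r \<in> vanishing_ideal n Z" "\<forall>k>d. hom_component k r = 0"
    using assms by (auto simp: leading_forms_def)
  then show ?thesis using carrier_Var[OF assms(2)] unfolding leading_forms_def
    by (intro CollectI exI[of _ "r * Var v"])
      (auto simp: vanishing_ideal_def eval.poly_eval_mult hom_component_mult_Var split: nat.split)
qed

text \<open>Constants preserve each space of leading forms and a variable shifts it up by one
  degree. This gives the absorption property of the ideal built in
  \<open>gr_ideal_iff\<close>.\<close>

lemma hom_component_mult_leading_forms:
  assumes "r \<in> carrier (mat_poly_ring n)" "\<And>d. hom_component d p \<in> leading_forms n Z d"
  shows "hom_component d (p * r) \<in> leading_forms n Z d"
  using assms(1)
proof (induction arbitrary: d rule: carrier_induct)
  case (Const c)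
  show ?case using leading_forms_Const_mult[OF assms(2)]
    by (simp add: mult.commute[of p] hom_component_Const_mult)
next
  case (Var q v)
  then show ?case using leading_forms_mult_Var
    by (auto simp: mult.assoc[symmetric] hom_component_mult_Var leading_forms_zero simp del: mem_Sigma_iff split: nat.split)
next
  case (add q s)
  then show ?case by (simp add: distrib_left hom_component_add leading_forms_add)
qed

lemma gr_ideal_ideal: "ideal (gr_ideal n (vanishing_ideal n Z)) (mat_poly_ring n)"
  unfolding gr_ideal_def
proof (rule ring.genideal_ideal)
  show "ring (mat_poly_ring n)" using mat_poly_cring by (rule cring.axioms)
  show "{top_component p | p. p \<in> vanishing_ideal n Z \<and> p \<noteq> 0} \<subseteq> carrier (mat_poly_ring n)"
    by (auto simp: vanishing_ideal_def top_component_def)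
qed

lemma ideal_add:
  "ideal I (mat_poly_ring n) \<Longrightarrow> p \<in> I \<Longrightarrow> q \<in> I \<Longrightarrow> p + q \<in> I"
  using additive_subgroup.a_closed[OF ideal.axioms(1), of I "mat_poly_ring n" p q] by simp

lemma ideal_zero: "ideal I (mat_poly_ring n) \<Longrightarrow> 0 \<in> I"
  using additive_subgroup.zero_closed[OF ideal.axioms(1), of I "mat_poly_ring n"] by simp

lemma ideal_mult:
  "ideal I (mat_poly_ring n) \<Longrightarrow> p \<in> I \<Longrightarrow> q \<in> carrier (mat_poly_ring n) \<Longrightarrow> q * p \<in> I"
  using ideal.I_l_closed[of I "mat_poly_ring n" p q] by simp

lemma ideal_uminus:
  assumes "ideal I (mat_poly_ring n)" "p \<in> I"
  shows "- p \<in> I"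
  using ideal_mult[OF assms, of "- 1"] by simp

lemma ideal_diff: "ideal I (mat_poly_ring n) \<Longrightarrow> p \<in> I \<Longrightarrow> q \<in> I \<Longrightarrow> p - q \<in> I"
  using ideal_add[of I n p "- q"] ideal_uminus[of I n q] by simp

text \<open>The right-hand side defines an ideal containing all generators, hence it contains the
  generated ideal. Conversely a leading form is zero or itself a generator, and a polynomial is the
  finite sum of its components.\<close>

lemma gr_ideal_iff:
  "p \<in> gr_ideal n (vanishing_ideal n Z) \<longleftrightarrow>
    p \<in> carrier (mat_poly_ring n) \<and> (\<forall>d. hom_component d p \<in> leading_forms n Z d)"
proof -
  let ?P = "mat_poly_ring n" and ?I = "gr_ideal n (vanishing_ideal n Z)"
  let ?J = "{p \<in> carrier ?P. \<forall>d. hom_component d p \<in> leading_forms n Z d}"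
  have ring: "ring ?P" using mat_poly_cring by (rule cring.axioms)
  have um: "- p \<in> ?J" if "p \<in> ?J" for p
    using that leading_forms_Const_mult[of _ n Z _ "- 1"]
    by (auto simp: hom_component_uminus Const_def single_uminus)
  have J: "ideal ?J ?P"
  proof (rule idealI)
    show "subgroup ?J (add_monoid ?P)"
    proof (rule group.subgroupI)
      show "group (add_monoid ?P)"
        by (rule abelian_group.a_group[OF ring.is_abelian_group[OF ring]])
      show "?J \<noteq> {}" using leading_forms_zero by (auto intro!: exI[of _ 0])
      fix p assume p: "p \<in> ?J"
      have "inv\<^bsub>add_monoid ?P\<^esub> p = - p"
        using p by (intro group.inv_equality abelian_group.a_group[OF ring.is_abelian_group[OF ring]]) auto
      then show "inv\<^bsub>add_monoid ?P\<^esub> p \<in> ?J" using um[OF p] by simp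
    qed (auto simp: hom_component_add leading_forms_add)
  next
    fix p x assume "p \<in> ?J" "x \<in> carrier ?P"
    then show "x \<otimes>\<^bsub>?P\<^esub> p \<in> ?J" "p \<otimes>\<^bsub>?P\<^esub> x \<in> ?J"
      using hom_component_mult_leading_forms[of x n p Z] by (auto simp: mult.commute)
  qed (rule ring)
  have "{top_component p | p. p \<in> vanishing_ideal n Z \<and> p \<noteq> 0} \<subseteq> ?J"
  proof clarify
    fix r assume r: "r \<in> vanishing_ideal n Z" "r \<noteq> 0"
    let ?t = "total_degree r"
    have "hom_component d (top_component r) \<in> leading_forms n Z d" for d
    proof (cases "d = ?t")
      case True
      have "hom_component ?t r \<in> leading_forms n Z ?t"
        using r total_degree_bound[OF r(2)] by (auto simp: leading_forms_def)
      then show ?thesis using True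
        by (simp add: top_component_def hom_component_homogeneous[where d = ?t])
    next
      case False
      then show ?thesis
        by (simp add: top_component_def hom_component_homogeneous[where d = ?t] leading_forms_zero)
    qed
    then show "top_component r \<in> carrier ?P \<and> (\<forall>d. hom_component d (top_component r) \<in> leading_forms n Z d)"
      using r(1) by (simp add: top_component_def vanishing_ideal_def)
  qed
  then have sub: "?I \<subseteq> ?J"
    unfolding gr_ideal_def by (rule ring.genideal_minimal[OF ring J])
  have leading: "q \<in> ?I" if q: "q \<in> leading_forms n Z d" for q d
  proof -
    obtain r where r: "q = hom_component d r" "r \<in> vanishing_ideal n Z" "\<forall>k>d. hom_component k r = 0"
      using q by (auto simp: leading_forms_def)
    show ?thesis
    proof (cases "q = 0")
      case True
      then show ?thesis using ideal_zero[OF gr_ideal_ideal] by simp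
    next
      case False
      then have "q = top_component r" "r \<noteq> 0" using r top_component_eq[of d r] by auto
      then have "q \<in> {top_component p | p. p \<in> vanishing_ideal n Z \<and> p \<noteq> 0}" using r(2) by blast
      moreover have "{top_component p | p. p \<in> vanishing_ideal n Z \<and> p \<noteq> 0} \<subseteq> carrier ?P"
        by (auto simp: vanishing_ideal_def top_component_def)
      ultimately show ?thesis unfolding gr_ideal_def using ring.genideal_self[OF ring] by blast
    qed
  qed
  have "p \<in> ?I" if "p \<in> ?J" for p
  proof -
    obtain D where D: "\<forall>k\<ge>D. hom_component k p = 0" using ex_degree_bound by blast
    have "(\<Sum>k<E. hom_component k p) \<in> ?I" for E
    proof (induction E)
      case (Suc E)
      have "hom_component E p \<in> ?I" by (rule leading[of _ E]) (use that in simp)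
      then show ?case using ideal_add[OF gr_ideal_ideal Suc] by simp
    qed (simp add: ideal_zero[OF gr_ideal_ideal])
    then show ?thesis using sum_hom_component[of D p] D by metis
  qed
  with sub show ?thesis by blast
qed

lemma gr_ideal_homogeneous:
  assumes "p \<in> carrier (mat_poly_ring n)" "homogeneous d p"
  shows "p \<in> gr_ideal n (vanishing_ideal n Z) \<longleftrightarrow> p \<in> leading_forms n Z d"
  using assms by (auto simp: gr_ideal_iff hom_component_homogeneous leading_forms_zero)

text \<open>If \<open>r\<close> witnesses a leading form, then \<open>poly_act g r\<close> witnesses
  its image: it still vanishes on the stable set \<open>Z\<close>, and the action respects
  degrees.\<close>

lemma gr_ideal_poly_act:
  assumes "g permutes {1..n}" "\<And>A. A \<in> Z \<Longrightarrow> A \<circ> map_prod g g \<in> Z"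
    and p: "p \<in> gr_ideal n (vanishing_ideal n Z)"
  shows "poly_act g p \<in> gr_ideal n (vanishing_ideal n Z)"
proof -
  have pc: "p \<in> carrier (mat_poly_ring n)" using p by (simp add: gr_ideal_iff)
  have "hom_component d (poly_act g p) \<in> leading_forms n Z d" for d
  proof -
    obtain r where r: "hom_component d p = hom_component d r" "r \<in> vanishing_ideal n Z"
      "\<forall>k>d. hom_component k r = 0"
      using p by (auto simp: gr_ideal_iff leading_forms_def)
    have rc: "r \<in> carrier (mat_poly_ring n)" using r by (simp add: vanishing_ideal_def)
    have "poly_act g r \<in> vanishing_ideal n Z"
      using r(2) assms(2) by (simp add: vanishing_ideal_def poly_act_closed assms(1) poly_eval_poly_act[OF assms(1)])
    moreover have "poly_act g 0 = 0" using poly_act_Const[of g 0] by (simp add: Const_def)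
    ultimately show ?thesis using r(1,3)
      by (auto simp: leading_forms_def hom_component_poly_act[OF assms(1) rc]
          hom_component_poly_act[OF assms(1) pc] intro!: exI[of _ "poly_act g r"])
  qed
  then show ?thesis using poly_act_closed[OF assms(1) pc] by (simp add: gr_ideal_iff)
qed

section \<open>Cosets and the representation on a graded component\<close>

lemma complex_ring_simps [simp]:
  "carrier complex_ring = UNIV" "mult complex_ring = (*)" "one complex_ring = 1"
  "zero complex_ring = 0" "add complex_ring = (+)"
  by (simp_all add: complex_ring_def)

lemma complex_cring: "cring complex_ring"
  by (intro cringI abelian_groupI comm_monoidI)
    (auto simp: algebra_simps intro!: exI[of _ "- x" for x])

lemma coset_eq: "I +>\<^bsub>mat_poly_ring n\<^esub> p = (\<lambda>i. i + p) ` I"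
  by (auto simp: a_r_coset_def r_coset_def)

lemma coset_eq_iff:
  assumes "ideal I (mat_poly_ring n)"
  shows "I +>\<^bsub>mat_poly_ring n\<^esub> p = I +>\<^bsub>mat_poly_ring n\<^esub> q \<longleftrightarrow> p - q \<in> I"
proof
  assume "I +>\<^bsub>mat_poly_ring n\<^esub> p = I +>\<^bsub>mat_poly_ring n\<^esub> q"
  moreover have "p \<in> (\<lambda>i. i + p) ` I" using ideal_zero[OF assms] by force
  ultimately show "p - q \<in> I" by (auto simp: coset_eq)
next
  assume d: "p - q \<in> I"
  have "i + p \<in> (\<lambda>i. i + q) ` I" if "i \<in> I" for i
    using ideal_add[OF assms that d] by (intro image_eqI[of _ _ "i + (p - q)"]) auto
  moreover have "i + q \<in> (\<lambda>i. i + p) ` I" if "i \<in> I" for i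
    using ideal_diff[OF assms that d] by (intro image_eqI[of _ _ "i - (p - q)"]) auto
  ultimately show "I +>\<^bsub>mat_poly_ring n\<^esub> p = I +>\<^bsub>mat_poly_ring n\<^esub> q"
    by (auto simp: coset_eq)
qed

context
  fixes n :: nat and Z :: "(nat \<times> nat \<Rightarrow> complex) set" and d :: nat
begin

abbreviation (input) "PR \<equiv> mat_poly_ring n"
abbreviation (input) "GI \<equiv> gr_ideal n (vanishing_ideal n Z)"
abbreviation (input) "OC \<equiv> orbit_harmonics_component n Z d"

lemma component_carrier:
  "A \<in> carrier OC \<longleftrightarrow> (\<exists>p. A = GI +>\<^bsub>PR\<^esub> p \<and> p \<in> carrier PR \<and> homogeneous d p)"
  by (auto simp: orbit_harmonics_component_def Let_def)

lemma component_add: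
  assumes "p \<in> carrier PR" "q \<in> carrier PR"
  shows "(GI +>\<^bsub>PR\<^esub> p) \<oplus>\<^bsub>OC\<^esub> (GI +>\<^bsub>PR\<^esub> q) = GI +>\<^bsub>PR\<^esub> (p + q)"
  using ideal.a_rcos_sum[OF gr_ideal_ideal assms]
  by (simp add: orbit_harmonics_component_def Let_def orbit_harmonics_ring_def FactRing_def)

lemma component_smult:
  assumes "p \<in> carrier PR"
  shows "c \<odot>\<^bsub>OC\<^esub> (GI +>\<^bsub>PR\<^esub> p) = GI +>\<^bsub>PR\<^esub> (Const c * p)"
  using ideal.rcoset_mult_add[OF gr_ideal_ideal, of "Const c" n p] assms
  by (simp add: orbit_harmonics_component_def Let_def orbit_harmonics_ring_def FactRing_def)

lemma component_zero: "\<zero>\<^bsub>OC\<^esub> = GI +>\<^bsub>PR\<^esub> 0"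
  by (simp add: orbit_harmonics_component_def Let_def orbit_harmonics_ring_def FactRing_def coset_eq)

text \<open>The set image of a coset is again a coset because \<open>poly_act g\<close> maps the
  ideal onto itself; surjectivity comes from the inverse permutation.\<close>

lemma component_act:
  assumes g: "g permutes {1..n}" and Z: "\<And>g A. g permutes {1..n} \<Longrightarrow> A \<in> Z \<Longrightarrow> A \<circ> map_prod g g \<in> Z"
    and p: "p \<in> carrier PR"
  shows "act OC g (GI +>\<^bsub>PR\<^esub> p) = GI +>\<^bsub>PR\<^esub> poly_act g p"
proof -
  have "i \<in> poly_act g ` GI" if i: "i \<in> GI" for i
  proof (rule image_eqI)
    have g': "inv_into UNIV g permutes {1..n}" using g by (rule permutes_inv)
    show "poly_act (inv_into UNIV g) i \<in> GI" using gr_ideal_poly_act[OF g' Z[OF g'] i] .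
    have "i \<in> carrier PR" using i by (simp add: gr_ideal_iff)
    then show "i = poly_act g (poly_act (inv_into UNIV g) i)"
      using poly_act_comp[of i n g "inv_into UNIV g"] poly_act_id[of i n] permutes_inv_o(1)[OF g] by simp
  qed
  then have "poly_act g ` GI = GI" using gr_ideal_poly_act[OF g Z[OF g]] by blast
  moreover have "poly_act g ` ((\<lambda>i. i + p) ` GI) = (\<lambda>i. i + poly_act g p) ` (poly_act g ` GI)"
    by (simp add: image_image poly_act_add)
  moreover have "act OC g A = poly_act g ` A" for A
    by (simp add: orbit_harmonics_component_def Let_def)
  ultimately show ?thesis by (simp add: coset_eq)
qed

lemma component_representation:
  assumes Z: "\<And>g A. g permutes {1..n} \<Longrightarrow> A \<in> Z \<Longrightarrow> A \<circ> map_prod g g \<in> Z"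
  shows "representation (sym_group n) complex_ring OC"
proof -
  note [simp] = component_add component_smult component_zero component_act[OF _ Z]
  have ag: "abelian_group OC"
  proof (rule abelian_groupI)
    fix A assume "A \<in> carrier OC"
    then obtain p where p: "A = GI +>\<^bsub>PR\<^esub> p" "p \<in> carrier PR" "homogeneous d p"
      by (auto simp: component_carrier)
    then have "(GI +>\<^bsub>PR\<^esub> (- p)) \<in> carrier OC"
      using homogeneous_uminus by (auto simp: component_carrier)
    then show "\<exists>B\<in>carrier OC. B \<oplus>\<^bsub>OC\<^esub> A = \<zero>\<^bsub>OC\<^esub>" using p by (intro bexI) auto
  qed (auto simp: component_carrier algebra_simps intro: homogeneous_add carrier_add homogeneous_zero carrier_zero)
  have m: "module complex_ring OC"
  proof (rule moduleI[OF complex_cring ag])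
    show "c \<odot>\<^bsub>OC\<^esub> A \<in> carrier OC" if "A \<in> carrier OC" for c A
      using that homogeneous_Const_mult by (auto simp: component_carrier)
  qed (auto simp: component_carrier algebra_simps act.add act.mult act.one)
  have "representation_axioms (sym_group n) complex_ring OC"
  proof
    fix g A assume "g \<in> carrier (sym_group n)" "A \<in> carrier OC"
    then obtain p where p: "A = GI +>\<^bsub>PR\<^esub> p" "p \<in> carrier PR" "homogeneous d p" "g permutes {1..n}"
      by (auto simp: component_carrier sym_group_carrier)
    then show "act OC g A \<in> carrier OC"
      unfolding component_carrier
      by (intro exI[of _ "poly_act g p"]) (simp add: poly_act_closed homogeneous_poly_act)
  qed (auto simp: component_carrier sym_group_carrier sym_group_mult sym_group_one poly_act_add
      poly_act_mult poly_act_closed permutes_compose poly_act_comp poly_act_id permutes_id)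
  with m show ?thesis by (intro representation.intro sym_group_is_group)
qed

end

text \<open>Two forms of degree \<open>d\<close> have the same coset exactly when their difference
  is a leading form. Equal spaces of leading forms therefore induce the same congruence on
  forms.\<close>

lemma component_isomorphic:
  assumes Z: "\<And>g A. g permutes {1..n} \<Longrightarrow> A \<in> Z \<Longrightarrow> A \<circ> map_prod g g \<in> Z"
    and Z': "\<And>g A. g permutes {1..n} \<Longrightarrow> A \<in> Z' \<Longrightarrow> A \<circ> map_prod g g \<in> Z'"
    and eq: "leading_forms n Z d = leading_forms n Z' d"
  shows "rep_isomorphic (sym_group n) complex_ring
    (orbit_harmonics_component n Z d) (orbit_harmonics_component n Z' d)"
proof -
  let ?P = "mat_poly_ring n"
  let ?I = "gr_ideal n (vanishing_ideal n Z)" and ?I' = "gr_ideal n (vanishing_ideal n Z')"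
  let ?V = "orbit_harmonics_component n Z d" and ?W = "orbit_harmonics_component n Z' d"
  \<comment> \<open>The representative must be homogeneous of degree \<open>d\<close>, since the two
    ideals are only known to agree on such forms; \<open>iff\<close> then shows that its choice is
    immaterial.\<close>
  define f where "f A = ?I' +>\<^bsub>?P\<^esub> (SOME p. p \<in> carrier ?P \<and> homogeneous d p \<and> A = ?I +>\<^bsub>?P\<^esub> p)" for A
  have iff: "?I +>\<^bsub>?P\<^esub> p = ?I +>\<^bsub>?P\<^esub> q \<longleftrightarrow> ?I' +>\<^bsub>?P\<^esub> p = ?I' +>\<^bsub>?P\<^esub> q"
    if "p \<in> carrier ?P" "homogeneous d p" "q \<in> carrier ?P" "homogeneous d q" for p q
    using that eq by (simp add: coset_eq_iff[OF gr_ideal_ideal] gr_ideal_homogeneous[where d = d] homogeneous_diff)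
  have f: "f (?I +>\<^bsub>?P\<^esub> p) = ?I' +>\<^bsub>?P\<^esub> p" if "p \<in> carrier ?P" "homogeneous d p" for p
  proof -
    let ?q = "SOME q. q \<in> carrier ?P \<and> homogeneous d q \<and> ?I +>\<^bsub>?P\<^esub> p = ?I +>\<^bsub>?P\<^esub> q"
    have "?q \<in> carrier ?P \<and> homogeneous d ?q \<and> ?I +>\<^bsub>?P\<^esub> p = ?I +>\<^bsub>?P\<^esub> ?q"
      by (rule someI[of _ p]) (use that in simp)
    then show ?thesis unfolding f_def using iff[OF that, of ?q] by auto
  qed
  have "bij_betw f (carrier ?V) (carrier ?W)"
    unfolding bij_betw_def
  proof
    show "inj_on f (carrier ?V)"
    proof (rule inj_onI)
      fix A B assume "A \<in> carrier ?V" "B \<in> carrier ?V" "f A = f B"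
      moreover from this obtain p q where "A = ?I +>\<^bsub>?P\<^esub> p" "p \<in> carrier ?P" "homogeneous d p"
        "B = ?I +>\<^bsub>?P\<^esub> q" "q \<in> carrier ?P" "homogeneous d q"
        unfolding component_carrier by blast
      ultimately show "A = B" by (simp add: f iff)
    qed
    show "f ` carrier ?V = carrier ?W"
    proof (intro equalityI subsetI)
      fix B assume "B \<in> carrier ?W"
      then obtain p where p: "B = ?I' +>\<^bsub>?P\<^esub> p" "p \<in> carrier ?P" "homogeneous d p"
        by (auto simp: component_carrier)
      then show "B \<in> f ` carrier ?V"
        by (intro image_eqI[of _ _ "?I +>\<^bsub>?P\<^esub> p"]) (auto simp: f component_carrier)
    next
      fix B assume "B \<in> f ` carrier ?V"
      then obtain p where "B = ?I' +>\<^bsub>?P\<^esub> p" "p \<in> carrier ?P" "homogeneous d p"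
        by (auto simp: component_carrier f)
      then show "B \<in> carrier ?W" by (auto simp: component_carrier)
    qed
  qed
  moreover have "f (A \<oplus>\<^bsub>?V\<^esub> B) = f A \<oplus>\<^bsub>?W\<^esub> f B" if "A \<in> carrier ?V" "B \<in> carrier ?V" for A B
    using that by (auto simp: component_carrier component_add f homogeneous_add)
  moreover have "f (c \<odot>\<^bsub>?V\<^esub> A) = c \<odot>\<^bsub>?W\<^esub> f A" if "A \<in> carrier ?V" for c A
    using that by (auto simp: component_carrier component_smult f homogeneous_Const_mult)
  moreover have "f (act ?V g A) = act ?W g (f A)" if "g \<in> carrier (sym_group n)" "A \<in> carrier ?V" for g A
    using that
    by (auto simp: component_carrier sym_group_carrier component_act[OF _ Z] component_act[OF _ Z'] f
        poly_act_closed homogeneous_poly_act)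
  ultimately have "f \<in> rep_iso (sym_group n) complex_ring ?V ?W" by (simp add: rep_iso_def)
  then show ?thesis
    unfolding rep_isomorphic_def using component_representation[OF Z] component_representation[OF Z'] by blast
qed

section \<open>Polynomials on the involution loci\<close>

definition edges :: "('a \<Rightarrow> 'a) \<Rightarrow> 'a set set"
  where "edges w = {{i, w i} | i. w i \<noteq> i}"

lemma edge_iff:
  assumes "w \<circ> w = id" "i \<noteq> j"
  shows "{i, j} \<in> edges w \<longleftrightarrow> w i = j"
proof -
  have "w (w k) = k" for k using assms(1) by (metis comp_apply id_apply)
  then show ?thesis using assms(2) by (auto simp: edges_def doubleton_eq_iff)
qed

text \<open>The edges cover exactly the points that are not fixed. Counting these
  \<open>n - a\<close> points, two per edge, gives the number of edges.\<close>

lemma edges_matching: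
  assumes "w \<in> involutions n a"
  shows "edges w \<in> matchings {1..n} ((n - a) div 2)"
proof -
  have w: "w permutes {1..n}" "w \<circ> w = id" "card {i \<in> {1..n}. w i = i} = a"
    using assms by (auto simp: involutions_def sym_group_carrier)
  have ww: "w (w k) = k" for k using w(2) by (metis comp_apply id_apply)
  have mem: "i \<in> {1..n}" "w i \<in> {1..n}" if "w i \<noteq> i" for i
    using that w(1) permutes_not_in permutes_in_image by metis+
  have sub: "edges w \<subseteq> Pow {1..n}"
  proof
    fix e assume "e \<in> edges w"
    then obtain i where "e = {i, w i}" "w i \<noteq> i" by (auto simp: edges_def)
    then show "e \<in> Pow {1..n}" using mem by blast
  qed
  moreover from this have "finite (edges w)" by (rule finite_subset) simp
  moreover have "\<forall>e\<in>edges w. card e = 2" by (auto simp: edges_def)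
  moreover have "pairwise disjnt (edges w)"
  proof (rule pairwiseI)
    fix e f assume "e \<in> edges w" "f \<in> edges w" "e \<noteq> f"
    then obtain i j where "e = {i, w i}" "f = {j, w j}" "e \<noteq> f" by (auto simp: edges_def)
    then show "disjnt e f" using ww by (auto simp: disjnt_def) (metis ww)+
  qed
  ultimately have E: "edges w \<in> matchings {1..n} (card (edges w))"
    by (simp add: matchings_def)
  have "\<Union>(edges w) = {1..n} - {i \<in> {1..n}. w i = i}"
  proof (intro equalityI subsetI)
    fix x assume "x \<in> \<Union>(edges w)"
    then obtain i where "w i \<noteq> i" "x = i \<or> x = w i" by (auto simp: edges_def)
    then have "w x \<noteq> x" using ww by metis
    then show "x \<in> {1..n} - {i \<in> {1..n}. w i = i}" using mem by blast
  qed (auto simp: edges_def)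
  then have "card ({1..n} - {i \<in> {1..n}. w i = i}) = 2 * card (edges w)"
    using card_Union_matching[OF E] by simp
  moreover have "card ({1..n} - {i \<in> {1..n}. w i = i}) = n - a"
    using w(3) by (subst card_Diff_subset) auto
  ultimately have "2 * card (edges w) = n - a" by simp
  then have "card (edges w) = (n - a) div 2" by simp
  with E show ?thesis by simp
qed

text \<open>The involution exchanges the endpoints of every edge and fixes all other points.
  Vanishing on the locus thus yields a condition for every \<open>m\<close>-matching.\<close>

lemma ex_involution:
  assumes N: "N \<in> matchings {1..n} m" and n: "a + 2 * m = n"
  shows "\<exists>w\<in>involutions n a. edges w = N"
proof -
  define w where "w i = (if i \<in> \<Union>N then SOME j. j \<noteq> i \<and> {i, j} \<in> N else i)" for i
  have pair: "e = f" if "e \<in> N" "f \<in> N" "x \<in> e" "x \<in> f" for e f x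
  proof (rule ccontr)
    assume "e \<noteq> f"
    then have "disjnt e f" using N that(1,2) by (auto simp: matchings_def pairwise_def)
    then show False using that(3,4) by (auto simp: disjnt_def)
  qed
  have w1: "w i \<noteq> i \<and> {i, w i} \<in> N" if i: "i \<in> \<Union>N" for i
  proof -
    obtain e where e: "e \<in> N" "i \<in> e" using i by blast
    then have "card e = 2" using N by (simp add: matchings_def)
    then obtain j where "e = {i, j}" "j \<noteq> i" using e(2) by (auto simp: card_2_iff)
    then have "j \<noteq> i \<and> {i, j} \<in> N" using e by simp
    then show ?thesis using someI[of "\<lambda>j. j \<noteq> i \<and> {i, j} \<in> N" j] i by (simp add: w_def)
  qed
  have uniq: "w i = j" if "{i, j} \<in> N" "i \<noteq> j" for i j
  proof -
    have "{i, w i} = {i, j}" using w1[of i] pair[of "{i, w i}" "{i, j}" i] that by blast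
    then show ?thesis using that(2) by (auto simp: doubleton_eq_iff)
  qed
  have ww: "w (w i) = i" for i
  proof (cases "i \<in> \<Union>N")
    case True
    then show ?thesis using w1[of i] uniq[of "w i" i] by (simp add: insert_commute)
  qed (simp add: w_def)
  have sub: "\<Union>N \<subseteq> {1..n}" using N by (auto simp: matchings_def)
  have fix_iff: "w i = i \<longleftrightarrow> i \<notin> \<Union>N" for i using w1[of i] by (auto simp: w_def)
  have "w permutes {1..n}"
  proof (rule bij_imp_permutes)
    show "bij_betw w {1..n} {1..n}"
    proof (rule bij_betw_byWitness[where f' = w])
      have "w i \<in> {1..n}" if "i \<in> {1..n}" for i
      proof (cases "i \<in> \<Union>N")
        case True
        then show ?thesis using w1[of i] sub by blast
      qed (use that in \<open>simp add: w_def\<close>)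
      then show "w ` {1..n} \<subseteq> {1..n}" "w ` {1..n} \<subseteq> {1..n}" by blast+
    qed (auto simp: ww)
    show "w i = i" if "i \<notin> {1..n}" for i using that sub fix_iff by blast
  qed
  moreover have "w \<circ> w = id" using ww by auto
  moreover have "card {i \<in> {1..n}. w i = i} = a"
  proof -
    have "{i \<in> {1..n}. w i = i} = {1..n} - \<Union>N" using fix_iff by blast
    then show ?thesis
      using card_Union_matching[OF N] sub n by (simp add: card_Diff_subset finite_subset)
  qed
  ultimately have "w \<in> involutions n a" by (simp add: involutions_def sym_group_carrier)
  moreover have "edges w = N"
  proof (intro equalityI subsetI)
    fix e assume e: "e \<in> N"
    then have "card e = 2" using N by (simp add: matchings_def)
    then obtain i j where "e = {i, j}" "i \<noteq> j" by (auto simp: card_2_iff)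
    then show "e \<in> edges w" using uniq[of i j] e by (auto simp: edges_def)
  qed (use w1 fix_iff in \<open>auto simp: edges_def\<close>)
  ultimately show ?thesis by blast
qed

text \<open>One family \<open>c\<close> serves all numbers \<open>a\<close> of fixed points
  simultaneously, which is what makes different loci comparable. The size bound is strict: degree at
  most \<open>k\<close> is expressed by \<open>Suc k\<close>, and bound \<open>0\<close> forces the
  zero function.\<close>

definition edge_poly :: "nat \<Rightarrow> nat \<Rightarrow> (nat set set \<Rightarrow> complex) \<Rightarrow> ((nat \<Rightarrow> nat) \<Rightarrow> complex) \<Rightarrow> bool"
  where "edge_poly n d c h \<longleftrightarrow> (\<forall>M. c M \<noteq> 0 \<longrightarrow> finite M \<and> card M < d)
    \<and> (\<forall>a. \<forall>w\<in>involutions n a. h w = (\<Sum>M\<in>Pow (edges w). c M))"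

lemma edges_finite: "w \<in> involutions n a \<Longrightarrow> finite (edges w)"
  using edges_matching matchings_finite by blast

lemma edge_poly_mono: "edge_poly n d c h \<Longrightarrow> d \<le> d' \<Longrightarrow> edge_poly n d' c h"
  by (fastforce simp: edge_poly_def)

lemma edge_poly_const: "edge_poly n (Suc 0) (\<lambda>M. if M = {} then z else 0) (\<lambda>w. z)"
  by (auto simp: edge_poly_def edges_finite)

lemma edge_poly_add: "edge_poly n d c h \<Longrightarrow> edge_poly n d c' h' \<Longrightarrow> edge_poly n d (\<lambda>M. c M + c' M) (\<lambda>w. h w + h' w)"
  unfolding edge_poly_def by (metis (mono_tags, lifting) add_0 sum.cong sum.distrib)

lemma edge_poly_uminus: "edge_poly n d c h \<Longrightarrow> edge_poly n d (\<lambda>M. - c M) (\<lambda>w. - h w)"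
  by (simp add: edge_poly_def sum_negf)

lemma ex_edge_poly_sum:
  assumes "\<And>i. i \<in> A \<Longrightarrow> \<exists>c. edge_poly n d c (h i)"
  shows "\<exists>c. edge_poly n d c (\<lambda>w. \<Sum>i\<in>A. h i w)"
  using assms
proof (induction A rule: infinite_finite_induct)
  case (insert i A)
  then show ?case using edge_poly_add[of n d _ "h i" _ "\<lambda>w. \<Sum>i\<in>A. h i w"] by fastforce
qed (auto simp: edge_poly_def intro: exI[of _ "\<lambda>M. 0"])

text \<open>If \<open>{i, j}\<close> is an edge, the subsets of \<open>edges w\<close> come in pairs
  \<open>L\<close>, \<open>insert {i, j} L\<close>, and the coefficients of both are collected at
  the larger set. Otherwise no subset contains \<open>{i, j}\<close> and both sides vanish.\<close>

lemma edge_poly_mult_edge: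
  assumes "edge_poly n d c h" "i \<noteq> j"
  shows "edge_poly n (Suc d) (\<lambda>M. if {i, j} \<in> M then c M + c (M - {{i, j}}) else 0)
    (\<lambda>w. of_bool (w i = j) * h w)"
  unfolding edge_poly_def
proof (intro conjI allI ballI)
  let ?c = "\<lambda>M. if {i, j} \<in> M then c M + c (M - {{i, j}}) else 0"
  show "?c M \<noteq> 0 \<longrightarrow> finite M \<and> card M < Suc d" for M
  proof (intro impI)
    assume "?c M \<noteq> 0"
    then have M: "{i, j} \<in> M" "c M \<noteq> 0 \<or> c (M - {{i, j}}) \<noteq> 0" by (auto split: if_splits)
    then show "finite M \<and> card M < Suc d"
    proof (elim disjE)
      assume "c M \<noteq> 0"
      then show ?thesis using assms(1) by (auto simp: edge_poly_def less_SucI)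
    next
      assume "c (M - {{i, j}}) \<noteq> 0"
      then have "finite (M - {{i, j}})" "card (M - {{i, j}}) < d" using assms(1) by (auto simp: edge_poly_def)
      then show ?thesis using M(1) by auto
    qed
  qed
  fix a w assume w: "w \<in> involutions n a"
  have iff: "{i, j} \<in> edges w \<longleftrightarrow> w i = j" using w by (intro edge_iff assms) (simp add: involutions_def)
  have hw: "h w = (\<Sum>M\<in>Pow (edges w). c M)" using assms(1) w by (auto simp: edge_poly_def)
  show "of_bool (w i = j) * h w = (\<Sum>M\<in>Pow (edges w). ?c M)"
  proof (cases "w i = j")
    case False
    then have "{i, j} \<notin> M" if "M \<in> Pow (edges w)" for M using iff that by blast
    then have "(\<Sum>M\<in>Pow (edges w). ?c M) = 0" by (intro sum.neutral) auto
    then show ?thesis using False by simp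
  next
    case True
    define E where "E = edges w - {{i, j}}"
    have E: "edges w = insert {i, j} E" "{i, j} \<notin> E" "finite E"
      using iff True edges_finite[OF w] by (auto simp: E_def)
    have split: "(\<Sum>M\<in>Pow (edges w). g M) = (\<Sum>M\<in>Pow E. g M) + (\<Sum>M\<in>Pow E. g (insert {i, j} M))"
      for g :: "nat set set \<Rightarrow> complex"
    proof -
      have "inj_on (insert {i, j}) (Pow E)"
      proof (rule inj_onI)
        fix L L' assume "L \<in> Pow E" "L' \<in> Pow E" "insert {i, j} L = insert {i, j} L'"
        moreover from this have "{i, j} \<notin> L" "{i, j} \<notin> L'" using E(2) by auto
        ultimately show "L = L'" by (simp add: insert_ident)
      qed
      moreover have "Pow E \<inter> insert {i, j} ` Pow E = {}" using E(2) by auto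
      ultimately show ?thesis using E by (simp add: Pow_insert sum.union_disjoint sum.reindex)
    qed
    have "(\<Sum>M\<in>Pow E. ?c M) = 0" using E(2) by (intro sum.neutral) auto
    moreover have "(\<Sum>M\<in>Pow E. ?c (insert {i, j} M)) = (\<Sum>M\<in>Pow E. c (insert {i, j} M) + c M)"
    proof (intro sum.cong refl)
      fix M assume "M \<in> Pow E"
      then have "{i, j} \<notin> M" using E(2) by blast
      then show "?c (insert {i, j} M) = c (insert {i, j} M) + c M" by simp
    qed
    ultimately have "(\<Sum>M\<in>Pow (edges w). ?c M) = (\<Sum>M\<in>Pow (edges w). c M)"
      unfolding split by (simp add: sum.distrib add.commute)
    then show ?thesis using True hw by simp
  qed
qed

text \<open>A diagonal variable is eliminated with \<open>x\<^sub>i\<^sub>i = 1 - (\<Sum>k \<noteq> i. x\<^sub>i\<^sub>k)\<close>.\<close>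

lemma ex_edge_poly_mult_entry:
  assumes "edge_poly n d c h" "v \<in> {1..n} \<times> {1..n}"
  shows "\<exists>c. edge_poly n (Suc d) c (\<lambda>w. perm_matrix n w v * h w)"
proof -
  obtain i j where v: "v = (i, j)" "i \<in> {1..n}" "j \<in> {1..n}" using assms(2) by blast
  have pm: "perm_matrix n w v = of_bool (w i = j)" for w using v by (simp add: perm_matrix_def)
  show ?thesis
  proof (cases "i = j")
    case False
    then show ?thesis using edge_poly_mult_edge[OF assms(1) False] by (auto simp: pm)
  next
    case True
    have "\<exists>c. edge_poly n (Suc d) c (\<lambda>w. \<Sum>k\<in>{1..n} - {i}. of_bool (w i = k) * h w)"
    proof (rule ex_edge_poly_sum)
      fix k assume "k \<in> {1..n} - {i}"
      then have "i \<noteq> k" by blast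
      from edge_poly_mult_edge[OF assms(1) this]
      show "\<exists>c. edge_poly n (Suc d) c (\<lambda>w. of_bool (w i = k) * h w)"
        by (rule exI[where P = "\<lambda>c. edge_poly n (Suc d) c (\<lambda>w. of_bool (w i = k) * h w)"])
    qed
    then obtain c' where "edge_poly n (Suc d) c' (\<lambda>w. \<Sum>k\<in>{1..n} - {i}. of_bool (w i = k) * h w)" ..
    then have c': "edge_poly n (Suc d) (\<lambda>M. c M + - c' M)
        (\<lambda>w. h w + - (\<Sum>k\<in>{1..n} - {i}. of_bool (w i = k) * h w))"
      by (intro edge_poly_add edge_poly_uminus edge_poly_mono[OF assms(1)]) simp_all
    have "h w + - (\<Sum>k\<in>{1..n} - {i}. of_bool (w i = k) * h w) = perm_matrix n w v * h w"
      if "w \<in> involutions n a" for w a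
    proof -
      have "w i \<in> {1..n}"
        using that v(2) permutes_in_image by (fastforce simp: involutions_def sym_group_carrier)
      then have "(\<Sum>k\<in>{1..n}. of_bool (w i = k) * h w) = h w"
        by (simp add: of_bool_def if_distrib[of "\<lambda>x. x * _"] cong: if_cong)
      moreover have "(\<Sum>k\<in>{1..n}. of_bool (w i = k) * h w)
          = of_bool (w i = i) * h w + (\<Sum>k\<in>{1..n} - {i}. of_bool (w i = k) * h w)"
        using v(2) by (intro sum.remove) auto
      ultimately have "h w = of_bool (w i = i) * h w + (\<Sum>k\<in>{1..n} - {i}. of_bool (w i = k) * h w)"
        by metis
      then have "h w + - (\<Sum>k\<in>{1..n} - {i}. of_bool (w i = k) * h w) = of_bool (w i = i) * h w"
        by (metis add_diff_cancel_right' diff_conv_add_uminus)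
      then show ?thesis using True pm by metis
    qed
    with c' show ?thesis unfolding edge_poly_def by (intro exI[of _ "\<lambda>M. c M + - c' M"]) auto
  qed
qed

text \<open>Each variable factor raises the size bound by at most one, so a form of degree
  \<open>d\<close> involves only sets of at most \<open>d\<close> edges.\<close>

lemma ex_edge_poly_hom_component:
  assumes "p \<in> carrier (mat_poly_ring n)"
  shows "\<exists>c. edge_poly n (Suc d) c (\<lambda>w. poly_eval (\<lambda>c. c) (perm_matrix n w) (hom_component d p))"
  using assms
proof (induction arbitrary: d rule: carrier_induct)
  case (Const z)
  have "hom_component d (Const z) = Const (if d = 0 then z else 0)"
    by (simp add: hom_component_Const) (simp add: Const_def)
  then show ?case
    using edge_poly_mono[OF edge_poly_const, of "Suc d" n] by (auto simp: eval.poly_eval_Const)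
next
  case (Var p v)
  show ?case
  proof (cases d)
    case 0
    then show ?thesis
      using edge_poly_const[of n 0] by (auto simp: hom_component_mult_Var eval.poly_eval_zero)
  next
    case (Suc k)
    obtain c where "edge_poly n (Suc k) c (\<lambda>w. poly_eval (\<lambda>c. c) (perm_matrix n w) (hom_component k p))"
      using Var.IH by blast
    from ex_edge_poly_mult_entry[OF this Var.hyps(2)] show ?thesis
      by (simp add: Suc hom_component_mult_Var eval.poly_eval_mult eval.poly_eval_Var mult.commute)
  qed
next
  case (add p q)
  then obtain c c' where "edge_poly n (Suc d) c (\<lambda>w. poly_eval (\<lambda>c. c) (perm_matrix n w) (hom_component d p))"
    "edge_poly n (Suc d) c' (\<lambda>w. poly_eval (\<lambda>c. c) (perm_matrix n w) (hom_component d q))" by blast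
  from edge_poly_add[OF this] show ?case by (auto simp: hom_component_add eval.poly_eval_add)
qed

section \<open>From coefficient families back to polynomials\<close>

lemma homogeneous_prod_Var:
  "finite M \<Longrightarrow> homogeneous (card M) (\<Prod>e\<in>M. Var (f e))"
proof (induction M rule: finite_induct)
  case empty
  show ?case using hom_component_Const[of 0 1] by (simp add: homogeneous_iff Const_def)
next
  case (insert e M)
  then show ?case by (simp add: homogeneous_iff mult.commute[of "Var _"] hom_component_mult_Var)
qed

text \<open>The matrix of an involution is symmetric, so either of the two variables of an edge
  detects it; \<open>Min\<close> and \<open>Max\<close> select one of them.\<close>

lemma eval_edge_monomial:
  assumes w: "w \<in> involutions n a" and M: "M \<in> matchings {1..n} k"
  shows "poly_eval (\<lambda>c. c) (perm_matrix n w) (\<Prod>e\<in>M. Var (Min e, Max e)) = of_bool (M \<subseteq> edges w)"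
proof -
  have "perm_matrix n w (Min e, Max e) = of_bool (e \<in> edges w)" if "e \<in> M" for e
  proof -
    have e: "card e = 2" "e \<subseteq> {1..n}" using M that by (auto simp: matchings_def)
    then obtain i j where "e = {i, j}" "i < j" by (metis card_2_iff insert_commute linorder_neqE_nat)
    moreover from this e have "i \<in> {1..n}" "j \<in> {1..n}" by blast+
    ultimately show ?thesis
      using edge_iff[of w i j] w by (simp add: perm_matrix_def involutions_def)
  qed
  then have "poly_eval (\<lambda>c. c) (perm_matrix n w) (\<Prod>e\<in>M. Var (Min e, Max e)) = (\<Prod>e\<in>M. of_bool (e \<in> edges w))"
    by (simp add: eval.poly_eval_prod eval.poly_eval_Var)
  also have "\<dots> = of_bool (M \<subseteq> edges w)"
    using matchings_finite[OF M] by (induction M rule: finite_induct) auto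
  finally show ?thesis .
qed

text \<open>The polynomial combines edge monomials over the matchings with fewer than
  \<open>d\<close> edges. This loses nothing, since every subset of \<open>edges w\<close> is a
  matching.\<close>

lemma ex_poly_of_edge_poly:
  assumes "\<And>M. c M \<noteq> 0 \<Longrightarrow> card M < d"
  shows "\<exists>q\<in>carrier (mat_poly_ring n). (\<forall>k\<ge>d. hom_component k q = 0) \<and>
    (\<forall>a. \<forall>w\<in>involutions n a. poly_eval (\<lambda>c. c) (perm_matrix n w) q = (\<Sum>M\<in>Pow (edges w). c M))"
proof -
  define S where "S = (\<Union>k<d. matchings {1..n} k)"
  define mono where "mono M = (\<Prod>e\<in>M. Var (Min e, Max e))" for M :: "nat set set"
  let ?q = "\<Sum>M\<in>S. Const (c M) * mono M"
  have "S \<subseteq> Pow (Pow {1..n})" by (auto simp: S_def matchings_def)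
  then have fin: "finite S" by (rule finite_subset) simp
  have carrier: "mono M \<in> carrier (mat_poly_ring n)" if "M \<in> S" for M
  proof -
    have "(Min e, Max e) \<in> {1..n} \<times> {1..n}" if "e \<in> M" for e
    proof -
      have "e \<subseteq> {1..n}" "card e = 2" using that \<open>M \<in> S\<close> by (auto simp: S_def matchings_def)
      moreover from this have "finite e" "e \<noteq> {}" by (auto intro: finite_subset)
      ultimately show ?thesis using Min_in[of e] Max_in[of e] by blast
    qed
    then have V: "Var (Min e, Max e) \<in> carrier (mat_poly_ring n)" if "e \<in> M" for e
      using carrier_Var that by blast
    have "(\<Prod>e\<in>T. Var (Min e, Max e)) \<in> carrier (mat_poly_ring n)" if "T \<subseteq> M" for T
      using that V by (induction T rule: infinite_finite_induct) auto
    then show ?thesis unfolding mono_def by blast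
  qed
  have hom: "homogeneous (card M) (mono M)" if "M \<in> S" for M
    unfolding mono_def by (rule homogeneous_prod_Var) (use that in \<open>auto simp: S_def matchings_def\<close>)
  have "hom_component k ?q = 0" if "k \<ge> d" for k
  proof -
    have "hom_component k (\<Sum>M\<in>T. Const (c M) * mono M) = 0" if "T \<subseteq> S" for T
      using finite_subset[OF that fin] that
    proof (induction T)
      case (insert M T)
      then have "card M \<noteq> k" using \<open>k \<ge> d\<close> by (auto simp: S_def matchings_def)
      then show ?case using insert hom[of M]
        by (auto simp: hom_component_add hom_component_Const_mult hom_component_homogeneous)
    qed simp
    then show ?thesis by blast
  qed
  moreover have "poly_eval (\<lambda>c. c) (perm_matrix n w) ?q = (\<Sum>M\<in>Pow (edges w). c M)"
    if w: "w \<in> involutions n a" for w a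
  proof -
    have "poly_eval (\<lambda>c. c) (perm_matrix n w) ?q = (\<Sum>M\<in>S. c M * of_bool (M \<subseteq> edges w))"
      unfolding eval.poly_eval_sum
      by (intro sum.cong)
        (auto simp: eval.poly_eval_mult eval.poly_eval_Const mono_def S_def eval_edge_monomial[OF w])
    also have "\<dots> = (\<Sum>M\<in>S \<inter> Pow (edges w). c M)"
      using fin by (intro sum.mono_neutral_cong_right) auto
    also have "\<dots> = (\<Sum>M\<in>Pow (edges w). c M)"
    proof (rule sum.mono_neutral_left)
      show "\<forall>M\<in>Pow (edges w) - S \<inter> Pow (edges w). c M = 0"
        using matchings_subset[OF edges_matching[OF w]] assms unfolding S_def by blast
    qed (use edges_finite[OF w] in auto)
    finally show ?thesis .
  qed
  moreover have "?q \<in> carrier (mat_poly_ring n)" using carrier by (intro carrier_sum) auto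
  ultimately show ?thesis by blast
qed

section \<open>Raising lower terms on sets of a fixed size\<close>

lemma sum_Pow_split:
  fixes c :: "'a set \<Rightarrow> 'b::comm_monoid_add"
  assumes "finite N" "\<And>M. c M \<noteq> 0 \<Longrightarrow> card M < Suc d"
  shows "(\<Sum>M\<in>Pow N. c M) = subset_sum d c N + (\<Sum>M\<in>Pow N. if card M < d then c M else 0)"
proof -
  have "(\<Sum>M\<in>Pow N. c M)
      = (\<Sum>M\<in>Pow N. (if card M = d then c M else 0) + (if card M < d then c M else 0))"
    using assms(2) by (intro sum.cong) (auto simp: less_Suc_eq)
  also have "(\<Sum>M\<in>Pow N. if card M = d then c M else 0) = subset_sum d c N"
    unfolding subset_sum_def using assms(1) by (intro sum.mono_neutral_cong_right) auto
  ultimately show ?thesis by (simp add: sum.distrib)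
qed

text \<open>Lower terms are lifted one size at a time with \<open>subset_sum_raise\<close>; the
  factors to be divided out are nonzero because \<open>k \<le> m\<close>.\<close>

lemma ex_subset_sum_eq:
  fixes c :: "'a set \<Rightarrow> 'b::field_char_0"
  assumes "\<And>M. c M \<noteq> 0 \<Longrightarrow> card M < Suc k" "k \<le> m"
  shows "\<exists>b. \<forall>N. finite N \<and> card N = m \<longrightarrow> (\<Sum>M\<in>Pow N. c M) = subset_sum k b N"
  using assms
proof (induction k arbitrary: c)
  case 0
  have "(\<Sum>M\<in>Pow N. c M) = subset_sum 0 c N" if "finite N" for N
    using sum_Pow_split[OF that, of c 0] 0 by simp
  then show ?case by blast
next
  case (Suc k)
  obtain b where b: "\<And>N. finite N \<Longrightarrow> card N = m
      \<Longrightarrow> (\<Sum>M\<in>Pow N. if card M < Suc k then c M else 0) = subset_sum k b N"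
  proof -
    have "\<exists>b. \<forall>N. finite N \<and> card N = m
        \<longrightarrow> (\<Sum>M\<in>Pow N. if card M < Suc k then c M else 0) = subset_sum k b N"
      using Suc.prems(2) by (intro Suc.IH) (auto split: if_splits)
    then show ?thesis using that by blast
  qed
  define b' where "b' M = c M + (\<Sum>e\<in>M. b (M - {e})) / of_nat (m - k)" for M
  have "(\<Sum>M\<in>Pow N. c M) = subset_sum (Suc k) b' N" if N: "finite N" "card N = m" for N
  proof -
    have "subset_sum (Suc k) (\<lambda>M. \<Sum>e\<in>M. b (M - {e})) N / of_nat (m - k) = subset_sum k b N"
      using subset_sum_raise[OF N(1), of k b] N(2) Suc.prems(2) by simp
    then have "subset_sum (Suc k) b' N = subset_sum (Suc k) c N + subset_sum k b N"
      by (simp add: b'_def subset_sum_def sum.distrib sum_divide_distrib)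
    then show ?thesis using sum_Pow_split[OF N(1), of c "Suc k"] Suc.prems(1) b[OF N] by simp
  qed
  then show ?case by blast
qed

text \<open>On the \<open>m\<close>-element sets a function of degree less than \<open>d\<close> is homogeneous of degree \<open>d\<close>, in
  such a way that it still has degree less than \<open>d\<close> on the sets of any other size \<open>m'\<close>.\<close>

lemma ex_subset_sum_transfer:
  fixes c :: "'a set \<Rightarrow> 'b::field_char_0"
  assumes "\<And>M. c M \<noteq> 0 \<Longrightarrow> card M < d" "d \<le> m"
  obtains c' b where "\<And>M. c' M \<noteq> 0 \<Longrightarrow> card M < d"
    and "\<And>N. finite N \<Longrightarrow> card N = m \<Longrightarrow> (\<Sum>M\<in>Pow N. c M) = subset_sum d b N"
    and "\<And>N. finite N \<Longrightarrow> card N = m' \<Longrightarrow> subset_sum d b N = (\<Sum>M\<in>Pow N. c' M)"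
proof (cases d)
  case 0
  then have "c M = 0" for M using assms(1)[of M] by auto
  then show ?thesis by (intro that[of "\<lambda>M. 0" "\<lambda>M. 0"]) (simp_all add: subset_sum_def)
next
  case (Suc k)
  then obtain b where b: "\<And>N. finite N \<Longrightarrow> card N = m \<Longrightarrow> (\<Sum>M\<in>Pow N. c M) = subset_sum k b N"
    using ex_subset_sum_eq[of c k m] assms by auto
  define b' where "b' M = (\<Sum>e\<in>M. b (M - {e})) / of_nat (m - k)" for M
  \<comment> \<open>Raising from \<open>k\<close> to \<open>Suc k\<close> multiplies by
    \<open>m - k\<close> on sets of size \<open>m\<close> and by \<open>m' - k\<close> on sets of
    size \<open>m'\<close>. As \<open>b'\<close> normalises the first factor, the ratio remains on
    the second kind of sets.\<close>
  define c' where "c' M = (if card M = k then of_nat (m' - k) / of_nat (m - k) * b M else 0)" for M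
  have b': "subset_sum d b' N = of_nat (card N - k) / of_nat (m - k) * subset_sum k b N" if "finite N" for N
    using subset_sum_raise[OF that, of k b]
    by (simp add: b'_def Suc subset_sum_def sum_divide_distrib[symmetric])
  show ?thesis
  proof (rule that)
    show "card M < d" if "c' M \<noteq> 0" for M using that by (simp add: c'_def Suc split: if_splits)
    show "(\<Sum>M\<in>Pow N. c M) = subset_sum d b' N" if "finite N" "card N = m" for N
      using b[OF that] b'[OF that(1)] that(2) assms(2) Suc by simp
    show "subset_sum d b' N = (\<Sum>M\<in>Pow N. c' M)" if N: "finite N" "card N = m'" for N
    proof -
      have "(\<Sum>M\<in>Pow N. c' M) = subset_sum k c' N"
        unfolding subset_sum_def using N(1) by (intro sum.mono_neutral_right) (auto simp: c'_def)
      also have "\<dots> = of_nat (m' - k) / of_nat (m - k) * subset_sum k b N"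
        by (simp add: subset_sum_def c'_def sum_distrib_left)
      finally show ?thesis using b'[OF N(1)] N(2) by simp
    qed
  qed
qed

text \<open>Let \<open>r\<close> vanish on the first locus with leading form \<open>p\<close>. There
  the size \<open>d\<close> part of \<open>p\<close> cancels against terms of lower degree, and by
  injectivity this cancellation holds coefficientwise on \<open>d\<close>-matchings. On the second
  locus \<open>p\<close> then agrees with a polynomial \<open>q\<close> of lower degree, so
  \<open>p - q\<close> is the required witness.\<close>

lemma leading_forms_involution_locus_subset:
  assumes n: "a + 2 * m = n" "a' + 2 * m' = n" and d: "d \<le> a" "d \<le> m"
  shows "leading_forms n (involution_locus n a) d \<subseteq> leading_forms n (involution_locus n a') d"
proof
  let ?ev = "\<lambda>w. poly_eval (\<lambda>c. c) (perm_matrix n w)"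
  fix p assume "p \<in> leading_forms n (involution_locus n a) d"
  then obtain r where r: "p = hom_component d r" "r \<in> vanishing_ideal n (involution_locus n a)"
    "\<forall>k>d. hom_component k r = 0"
    by (auto simp: leading_forms_def)
  have rc: "r \<in> carrier (mat_poly_ring n)" using r(2) by (simp add: vanishing_ideal_def)
  obtain cp where cp: "edge_poly n (Suc d) cp (\<lambda>w. ?ev w p)"
    using ex_edge_poly_hom_component[OF rc] r(1) by blast
  have "\<exists>c. edge_poly n d c (\<lambda>w. \<Sum>k<d. ?ev w (hom_component k r))"
  proof (rule ex_edge_poly_sum)
    fix k assume "k \<in> {..<d}"
    then have "Suc k \<le> d" by simp
    obtain c where "edge_poly n (Suc k) c (\<lambda>w. ?ev w (hom_component k r))"
      using ex_edge_poly_hom_component[OF rc] by blast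
    from edge_poly_mono[OF this \<open>Suc k \<le> d\<close>]
    show "\<exists>c. edge_poly n d c (\<lambda>w. ?ev w (hom_component k r))" by blast
  qed
  then obtain cq where cq: "edge_poly n d cq (\<lambda>w. \<Sum>k<d. ?ev w (hom_component k r))" ..
  have "r = (\<Sum>k<Suc d. hom_component k r)" using r(3) by (intro sum_hom_component) auto
  then have r_split: "?ev w r = ?ev w p + (\<Sum>k<d. ?ev w (hom_component k r))" for w
    using eval.poly_eval_sum[of "perm_matrix n w" "\<lambda>k. hom_component k r" "{..<Suc d}"] r(1) by simp
  \<comment> \<open>Although \<open>p\<close> is homogeneous, its expansion can contain smaller
    sets: eliminating a diagonal variable produces a constant, and repeated factors for the same
    edge collapse.\<close>
  let ?lo = "\<lambda>M. if card M < d then cp M else 0"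
  have cp_split: "?ev w p = subset_sum d cp (edges w) + (\<Sum>M\<in>Pow (edges w). ?lo M)"
    if "w \<in> involutions n b" for w b
  proof -
    have "?ev w p = (\<Sum>M\<in>Pow (edges w). cp M)" using cp that by (auto simp: edge_poly_def)
    also have "\<dots> = subset_sum d cp (edges w) + (\<Sum>M\<in>Pow (edges w). ?lo M)"
      using cp by (intro sum_Pow_split edges_finite[OF that]) (auto simp: edge_poly_def)
    finally show ?thesis .
  qed
  have low: "card M < d" if "?lo M + cq M \<noteq> 0" for M
  proof (rule ccontr)
    assume "\<not> card M < d"
    moreover from this have "cq M = 0" using cq by (auto simp: edge_poly_def)
    ultimately show False using that by simp
  qed
  obtain c' b where c'_low: "\<And>M. c' M \<noteq> 0 \<Longrightarrow> card M < d"
    and b_m: "\<And>N. finite N \<Longrightarrow> card N = m \<Longrightarrow> (\<Sum>M\<in>Pow N. ?lo M + cq M) = subset_sum d b N"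
    and b_m': "\<And>N. finite N \<Longrightarrow> card N = m' \<Longrightarrow> subset_sum d b N = (\<Sum>M\<in>Pow N. c' M)"
    by (rule ex_subset_sum_transfer[where c = "\<lambda>M. ?lo M + cq M" and m' = m', OF low d(2)]) (assumption | rule that)+
  \<comment> \<open>The size condition of the injectivity lemma reads
    \<open>2 * m + d \<le> n\<close>, which is \<open>d \<le> a\<close>. Every
    \<open>m\<close>-matching comes from an involution on which \<open>r\<close> vanishes.\<close>
  have zero: "cp M + b M = 0" if "M \<in> matchings {1..n} d" for M
  proof (rule subset_sum_matchings_inj[where V = "{1..n}" and m = m and f = "\<lambda>M. cp M + b M" and k = d])
    fix N assume N: "N \<in> matchings {1..n} m"
    then obtain w where w: "w \<in> involutions n a" "edges w = N" using ex_involution n(1) by blast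
    have "0 = ?ev w r" using r(2) w(1) by (simp add: vanishing_ideal_def involution_locus_def)
    also have "\<dots> = subset_sum d cp N + (\<Sum>M\<in>Pow N. ?lo M) + (\<Sum>M\<in>Pow N. cq M)"
      using r_split[of w] cp_split[OF w(1)] cq w by (auto simp: edge_poly_def)
    also have "\<dots> = subset_sum d cp N + (\<Sum>M\<in>Pow N. ?lo M + cq M)" by (simp add: sum.distrib add.assoc)
    also have "\<dots> = subset_sum d cp N + subset_sum d b N"
      using b_m matchings_finite[OF N] matchings_card[OF N] by simp
    finally show "subset_sum d (\<lambda>M. cp M + b M) N = 0" by (simp add: subset_sum_def sum.distrib)
  qed (use n d that in auto)
  \<comment> \<open>On the second locus the size \<open>d\<close> part of \<open>p\<close> sums to
    the negative of the sum of \<open>c'\<close>, so \<open>?lo M - c' M\<close> are the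
    coefficients of \<open>p\<close> there, all at sizes below \<open>d\<close>.\<close>
  have "\<exists>q\<in>carrier (mat_poly_ring n). (\<forall>k\<ge>d. hom_component k q = 0) \<and>
    (\<forall>a. \<forall>w\<in>involutions n a. ?ev w q = (\<Sum>M\<in>Pow (edges w). ?lo M - c' M))"
  proof (rule ex_poly_of_edge_poly)
    show "card M < d" if "?lo M - c' M \<noteq> 0" for M
      using that c'_low[of M] by (cases "card M < d") auto
  qed
  then obtain q where q: "q \<in> carrier (mat_poly_ring n)" "\<And>k. k \<ge> d \<Longrightarrow> hom_component k q = 0"
    "\<And>a w. w \<in> involutions n a \<Longrightarrow> ?ev w q = (\<Sum>M\<in>Pow (edges w). ?lo M - c' M)" by blast
  have "?ev w (p - q) = 0" if w: "w \<in> involutions n a'" for w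
  proof -
    have E: "edges w \<in> matchings {1..n} m'" using edges_matching[OF w] n(2) by (metis add_diff_cancel_left' nonzero_mult_div_cancel_left zero_neq_numeral)
    have "subset_sum d cp (edges w) = - subset_sum d b (edges w)"
      unfolding subset_sum_def sum_negf[symmetric]
      using zero matchings_subset[OF E] by (intro sum.cong) (auto simp: eq_neg_iff_add_eq_0)
    also have "\<dots> = - (\<Sum>M\<in>Pow (edges w). c' M)"
      using b_m' matchings_finite[OF E] matchings_card[OF E] by simp
    finally show ?thesis
      using cp_split[OF w] q(3)[OF w] by (simp add: eval.poly_eval_diff sum_subtractf)
  qed
  then have "p - q \<in> vanishing_ideal n (involution_locus n a')"
    using q(1) rc r(1) by (simp add: vanishing_ideal_def involution_locus_def)
  moreover have "hom_component k (p - q) = (if k = d then p else 0)" if "k \<ge> d" for k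
    using q(2)[OF that] r(1) by (simp add: hom_component_diff hom_component_homogeneous[where d = d])
  ultimately show "p \<in> leading_forms n (involution_locus n a') d"
    unfolding leading_forms_def by (intro CollectI exI[of _ "p - q"]) simp
qed

text \<open>Reindexing rows and columns by \<open>g\<close> replaces \<open>w\<close> by its
  conjugate \<open>g\<^sup>-\<^sup>1 w g\<close>, and \<open>g\<close> carries the fixed points of
  the conjugate onto those of \<open>w\<close>.\<close>

lemma involution_locus_conj:
  assumes g: "g permutes {1..n}" and A: "A \<in> involution_locus n a"
  shows "A \<circ> map_prod g g \<in> involution_locus n a"
proof -
  let ?g' = "inv_into UNIV g"
  obtain w where w: "w \<in> involutions n a" "A = perm_matrix n w" using A by (auto simp: involution_locus_def)
  have wp: "w permutes {1..n}" "w \<circ> w = id" "card {i \<in> {1..n}. w i = i} = a"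
    using w(1) by (auto simp: involutions_def sym_group_carrier)
  have g': "?g' (g x) = x" "g (?g' x) = x" for x
    using permutes_inverses[OF g] by auto
  let ?v = "?g' \<circ> w \<circ> g"
  have "?v permutes {1..n}" using g wp(1) by (intro permutes_compose permutes_inv) auto
  moreover have "?v \<circ> ?v = id"
    using wp(2) by (auto simp: fun_eq_iff g')
  moreover have "card {i \<in> {1..n}. ?v i = i} = a"
  proof -
    have img: "g ` {i \<in> {1..n}. ?v i = i} = {i \<in> {1..n}. w i = i}"
    proof (intro equalityI subsetI)
      fix i assume i: "i \<in> {i \<in> {1..n}. w i = i}"
      then have "?g' i \<in> {i \<in> {1..n}. ?v i = i}"
        using permutes_in_image[OF permutes_inv[OF g], of i] by (simp add: g')
      then show "i \<in> g ` {i \<in> {1..n}. ?v i = i}" by (rule rev_image_eqI) (simp add: g')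
    next
      fix x assume "x \<in> g ` {i \<in> {1..n}. ?v i = i}"
      then obtain i where i: "x = g i" "i \<in> {1..n}" "?g' (w (g i)) = i" by auto
      then have "w (g i) = g i" by (metis g'(2))
      then show "x \<in> {i \<in> {1..n}. w i = i}" using i(1,2) permutes_in_image[OF g, of i] by simp
    qed
    have "inj_on g {i \<in> {1..n}. ?v i = i}" using permutes_inj[OF g] by (rule inj_on_subset) simp
    from card_image[OF this] show ?thesis unfolding img wp(3) by (rule sym)
  qed
  ultimately have "?v \<in> involutions n a" by (simp add: involutions_def sym_group_carrier)
  moreover have "A \<circ> map_prod g g = perm_matrix n ?v"
  proof (rule ext)
    fix x :: "nat \<times> nat"
    obtain i j where "x = (i, j)" by fastforce
    moreover have "w (g i) = g j \<longleftrightarrow> ?g' (w (g i)) = j" using g' by metis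
    ultimately show "(A \<circ> map_prod g g) x = perm_matrix n ?v x"
      using permutes_in_image[OF g] by (simp add: w(2) perm_matrix_def del: atLeastAtMost_iff)
  qed
  ultimately show ?thesis by (auto simp: involution_locus_def)
qed

theorem corollary5p2:
  fixes n a a' d :: nat
  assumes "n > 0" and "max a a' \<le> n"
    and "[a = a'] (mod 2)" and "[a' = n] (mod 2)"
    and "d \<le> Min {a, a', (n - a) div 2, (n - a') div 2}"
  shows "rep_isomorphic (sym_group n) complex_ring
    (orbit_harmonics_component n (involution_locus n a) d)
    (orbit_harmonics_component n (involution_locus n a') d)"
proof (intro component_isomorphic involution_locus_conj)
  \<comment> \<open>Parity makes the halves exact, so fixed points and edges together account for
    all \<open>n\<close> points; for \<open>a\<close> the parity is obtained through
    \<open>a'\<close>.\<close>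
  have "2 dvd n - a'" "2 dvd n - a"
    using assms cong_altdef_nat'[of n a' 2] cong_altdef_nat'[of n a 2] by (auto simp: cong_def)
  then have "a + 2 * ((n - a) div 2) = n" "a' + 2 * ((n - a') div 2) = n" using assms(2) by auto
  \<comment> \<open>The bound on \<open>d\<close> is symmetric in \<open>a\<close> and
    \<open>a'\<close>, so the inclusion applies in both directions.\<close>
  then show "leading_forms n (involution_locus n a) d = leading_forms n (involution_locus n a') d"
    using assms(5) by (intro equalityI leading_forms_involution_locus_subset) auto
qed auto

end
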